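(* Let $(\mathfrak{g}, [~,~]_\mathfrak{g})$ be a Lie algebra. For $m,n\ge0$ let $$\rho : \mathrm{Hom} (\wedge^{m+1} \mathfrak{g}, \mathfrak{g}) \times \mathrm{Hom} (\wedge^{n} \mathfrak{g}, \mathfrak{g}) \to \mathrm{Hom} (\wedge^{m+n} \mathfrak{g}, \mathfrak{g}),\qquad (P,Q)\mapsto\rho_PQ:=i_PQ.$$ Then the quadruple $$\big( (\oplus_{n \geq 0} \mathrm{Hom} (\wedge^{n+1} \mathfrak{g}, \mathfrak{g}), [~,~]_\mathrm{NR}),\ (\oplus_{n \geq 0} \mathrm{Hom} (\wedge^{n} \mathfrak{g}, \mathfrak{g}), [~,~]_\mathrm{cup}),\ \rho,\ \psi= 0 \big)$$ is a matched pair of graded Lie algebras.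
   Context: All vector spaces and (multi)linear maps are over a field $\mathbf{k}$ of characteristic zero. Insertion: for $P\in\mathrm{Hom}(\wedge^{m+1}\mathfrak{g},\mathfrak{g})$ and $Q\in\mathrm{Hom}(\wedge^n\mathfrak{g},\mathfrak{g})$, $$(i_PQ)(x_1,\ldots,x_{m+n})=\sum_{\sigma\in\mathrm{Sh}(m+1,n-1)}(-1)^\sigma Q(P(x_{\sigma(1)},\ldots,x_{\sigma(m+1)}),x_{\sigma(m+2)},\ldots,x_{\sigma(m+n)}),$$ with $i_PQ=0$ if $n=0$. For $P\in\mathrm{Hom}(\wedge^{m+1}\mathfrak{g},\mathfrak{g})$, $Q\in\mathrm{Hom}(\wedge^{n+1}\mathfrak{g},\mathfrak{g})$ the Nijenhuis-Richardson bracket is $[P,Q]_\mathrm{NR}=i_PQ-(-1)^{mn}i_QP$; it makes $\oplus_{n\ge0}\mathrm{Hom}(\wedge^{n+1}\mathfrak{g},\mathfrak{g})$ a graded Lie algebra with $\mathrm{Hom}(\wedge^{n+1}\mathfrak{g},\mathfrak{g})$ in degree $n$. The cup-product of $P\in\mathrm{Hom}(\wedge^m\mathfrak{g},\mathfrak{g})$ and $Q\in\mathrm{Hom}(\wedge^n\mathfrak{g},\mathfrak{g})$ is $$[P,Q]_\mathrm{cup}(x_1,\ldots,x_{m+n})=\sum_{\sigma\in\mathrm{Sh}(m,n)}(-1)^\sigma[P(x_{\sigma(1)},\ldots,x_{\sigma(m)}),Q(x_{\sigma(m+1)},\ldots,x_{\sigma(m+n)})]_\mathfrak{g};$$ it makes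 $\oplus_{n\ge0}\mathrm{Hom}(\wedge^n\mathfrak{g},\mathfrak{g})$ a graded Lie algebra with $\mathrm{Hom}(\wedge^n\mathfrak{g},\mathfrak{g})$ in degree $n$. A matched pair of graded Lie algebras is a quadruple $(\mathcal{G},\mathcal{H},\rho,\psi)$ with $\mathcal{G},\mathcal{H}$ graded Lie algebras and degree $0$ graded bilinear maps $\rho:\mathcal{G}\times\mathcal{H}\to\mathcal{H}$, $\psi:\mathcal{H}\times\mathcal{G}\to\mathcal{G}$ such that for all homogeneous $x,y\in\mathcal{G}$, $h,k\in\mathcal{H}$: $$\rho_{[x,y]_\mathcal{G}} h = \rho_x \rho_y h - (-1)^{|x| |y|} \rho_y \rho_x h,\qquad \psi_{[h, k]_\mathcal{H}} x = \psi_h \psi_k x - (-1)^{|h| |k|} \psi_k \psi_h x,$$ $$\rho_x ([h, k]_\mathcal{H}) = [\rho_x h, k]_\mathcal{H} + (-1)^{|x| |h|} [h, \rho_x k]_\mathcal{H} + (-1)^{(|x| + |h|)|k|} \rho_{\psi_k x} h -(-1)^{|x| |h|} \rho_{\psi_h x} k,$$ $$\psi_h ([x, y]_\mathcal{G}) = [\psi_h x, y]_\mathcal{G} + (-1)^{|h| |x|} [x, \psi_h y]_\mathcal{G} + (-1)^{(|h| + |x|)|y|} \psi_{\rho_y h} x - (-1)^{|h||x|} \psi_{\rho_x h} y.$$ *)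

theory Defs
  imports Complex_Main "HOL-Library.Function_Algebras" "HOL-Combinatorics.Permutations"
begin

section \<open>Graded Lie algebras and matched pairs\<close>

text \<open>
  A graded vector space is presented as an internal direct sum: an ambient vector space together
  with independent subspaces \<open>V i\<close> (\<open>i \<in> \<int>\<close>); the graded vector space itself is their sum, called
  \<open>total\<close> below, which need not be the whole ambient space. Everything is relativised to it.
\<close>

locale graded_vector_space = vector_space scale
  for scale :: "'k::field_char_0 \<Rightarrow> 'a::ab_group_add \<Rightarrow> 'a" +
  fixes V :: "int \<Rightarrow> 'a set"
  assumes subspace_component: "subspace (V i)"
    and independent_components:
      "\<lbrakk>finite I; \<And>i. i \<in> I \<Longrightarrow> v i \<in> V i; (\<Sum>i\<in>I. v i) = 0; j \<in> I\<rbrakk> \<Longrightarrow> v j = 0"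
begin

definition total :: "'a set" where
  "total = span (\<Union>i. V i)"

end

definition bilinear_on ::
  "('k::field_char_0 \<Rightarrow> 'a::ab_group_add \<Rightarrow> 'a) \<Rightarrow> ('k \<Rightarrow> 'b::ab_group_add \<Rightarrow> 'b) \<Rightarrow>
   ('k \<Rightarrow> 'c::ab_group_add \<Rightarrow> 'c) \<Rightarrow> 'a set \<Rightarrow> 'b set \<Rightarrow> ('a \<Rightarrow> 'b \<Rightarrow> 'c) \<Rightarrow> bool" where
  "bilinear_on sA sB sC A B f \<longleftrightarrow>
     (\<forall>x\<in>A. \<forall>x'\<in>A. \<forall>y\<in>B. f (x + x') y = f x y + f x' y) \<and>
     (\<forall>x\<in>A. \<forall>y\<in>B. \<forall>y'\<in>B. f x (y + y') = f x y + f x y') \<and>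
     (\<forall>c. \<forall>x\<in>A. \<forall>y\<in>B. f (sA c x) y = sC c (f x y)) \<and>
     (\<forall>c. \<forall>x\<in>A. \<forall>y\<in>B. f x (sB c y) = sC c (f x y))"

definition degree0_map ::
  "(int \<Rightarrow> 'a set) \<Rightarrow> (int \<Rightarrow> 'b set) \<Rightarrow> (int \<Rightarrow> 'c set) \<Rightarrow> ('a \<Rightarrow> 'b \<Rightarrow> 'c) \<Rightarrow> bool" where
  "degree0_map A B C f \<longleftrightarrow> (\<forall>i j. \<forall>x\<in>A i. \<forall>y\<in>B j. f x y \<in> C (i + j))"

locale graded_lie_algebra = graded_vector_space scale V
  for scale :: "'k::field_char_0 \<Rightarrow> 'a::ab_group_add \<Rightarrow> 'a" and V :: "int \<Rightarrow> 'a set" +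
  fixes bracket :: "'a \<Rightarrow> 'a \<Rightarrow> 'a"
  assumes bracket_bilinear: "bilinear_on scale scale scale total total bracket"
    and bracket_degree: "degree0_map V V V bracket"
    and graded_skew: "\<lbrakk>x \<in> V i; y \<in> V j\<rbrakk> \<Longrightarrow>
      bracket x y = - scale ((-1) powi (i * j)) (bracket y x)"
    and graded_jacobi: "\<lbrakk>x \<in> V i; y \<in> V j; z \<in> V k\<rbrakk> \<Longrightarrow>
      bracket x (bracket y z) =
        bracket (bracket x y) z + scale ((-1) powi (i * j)) (bracket y (bracket x z))"

locale matched_pair =
  G: graded_lie_algebra sG G brG + H: graded_lie_algebra sH H brH
  for sG :: "'k::field_char_0 \<Rightarrow> 'a::ab_group_add \<Rightarrow> 'a" and G :: "int \<Rightarrow> 'a set"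
    and brG :: "'a \<Rightarrow> 'a \<Rightarrow> 'a"
    and sH :: "'k \<Rightarrow> 'b::ab_group_add \<Rightarrow> 'b" and H :: "int \<Rightarrow> 'b set"
    and brH :: "'b \<Rightarrow> 'b \<Rightarrow> 'b" +
  fixes \<rho> :: "'a \<Rightarrow> 'b \<Rightarrow> 'b" and \<psi> :: "'b \<Rightarrow> 'a \<Rightarrow> 'a"
  assumes rho_bilinear: "bilinear_on sG sH sH G.total H.total \<rho>"
    and rho_degree: "degree0_map G H H \<rho>"
    and psi_bilinear: "bilinear_on sH sG sG H.total G.total \<psi>"
    and psi_degree: "degree0_map H G G \<psi>"
    and rho_action: "\<lbrakk>x \<in> G i; y \<in> G j; h \<in> H p\<rbrakk> \<Longrightarrow>
      \<rho> (brG x y) h = \<rho> x (\<rho> y h) - sH ((-1) powi (i * j)) (\<rho> y (\<rho> x h))"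
    and psi_action: "\<lbrakk>h \<in> H p; k \<in> H q; x \<in> G i\<rbrakk> \<Longrightarrow>
      \<psi> (brH h k) x = \<psi> h (\<psi> k x) - sG ((-1) powi (p * q)) (\<psi> k (\<psi> h x))"
    and rho_compat: "\<lbrakk>x \<in> G i; h \<in> H p; k \<in> H q\<rbrakk> \<Longrightarrow>
      \<rho> x (brH h k) = brH (\<rho> x h) k + sH ((-1) powi (i * p)) (brH h (\<rho> x k))
        + sH ((-1) powi ((i + p) * q)) (\<rho> (\<psi> k x) h)
        - sH ((-1) powi (i * p)) (\<rho> (\<psi> h x) k)"
    and psi_compat: "\<lbrakk>h \<in> H p; x \<in> G i; y \<in> G j\<rbrakk> \<Longrightarrow>
      \<psi> h (brG x y) = brG (\<psi> h x) y + sG ((-1) powi (p * i)) (brG x (\<psi> h y))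
        + sG ((-1) powi ((p + i) * j)) (\<psi> (\<rho> y h) x)
        - sG ((-1) powi (p * i)) (\<psi> (\<rho> x h) y)"


section \<open>Lie algebras and alternating multilinear maps\<close>

locale lie_algebra = vector_space scale
  for scale :: "'k::field_char_0 \<Rightarrow> 'g::ab_group_add \<Rightarrow> 'g" +
  fixes br :: "'g \<Rightarrow> 'g \<Rightarrow> 'g"
  assumes br_linear_right: "Vector_Spaces.linear scale scale (br x)"
    and br_linear_left: "Vector_Spaces.linear scale scale (\<lambda>x. br x y)"
    and br_self: "br x x = 0"
    and br_jacobi: "br x (br y z) + br y (br z x) + br z (br x y) = 0"

text \<open>
  \<open>Hom(\<and>\<^sup>n \<gg>, \<gg>)\<close> is the space of alternating \<open>n\<close>-linear maps. Arguments are passed as a list of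
  length \<open>n\<close>, and maps are extended by zero to lists of other lengths. Hence all these spaces are
  subspaces of the single function space \<open>\<gg> list \<Rightarrow> \<gg>\<close>, where they are independent; the case
  \<open>n = 0\<close> is a copy of \<open>\<gg>\<close> via \<open>P []\<close>.
\<close>

definition alt_hom :: "('k::field_char_0 \<Rightarrow> 'g::ab_group_add \<Rightarrow> 'g) \<Rightarrow> nat \<Rightarrow> ('g list \<Rightarrow> 'g) set"
  where
  "alt_hom scale n = {P.
     (\<forall>xs. length xs \<noteq> n \<longrightarrow> P xs = 0) \<and>
     (\<forall>xs i. length xs = n \<longrightarrow> i < n \<longrightarrow>
        Vector_Spaces.linear scale scale (\<lambda>x. P (xs[i := x]))) \<and>
     (\<forall>xs i j. length xs = n \<longrightarrow> i < n \<longrightarrow> j < n \<longrightarrow> i \<noteq> j \<longrightarrow> xs ! i = xs ! j \<longrightarrow> P xs = 0)}"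

definition fun_scale :: "('k \<Rightarrow> 'g \<Rightarrow> 'g) \<Rightarrow> 'k \<Rightarrow> ('g list \<Rightarrow> 'g) \<Rightarrow> ('g list \<Rightarrow> 'g)" where
  "fun_scale scale c P = (\<lambda>xs. scale c (P xs))"

definition nonneg_graded :: "(nat \<Rightarrow> 'a::zero set) \<Rightarrow> int \<Rightarrow> 'a set" where
  "nonneg_graded A i = (if 0 \<le> i then A (nat i) else {0})"


section \<open>Shuffles, insertion, Nijenhuis-Richardson bracket, cup product\<close>

text \<open>Shuffles act on the 0-based index set \<open>{..<p + q}\<close>.\<close>

definition shuffle_perms :: "nat \<Rightarrow> nat \<Rightarrow> (nat \<Rightarrow> nat) set" where
  "shuffle_perms p q = {\<sigma>. \<sigma> permutes {..<p + q} \<and>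
     strict_mono_on {..<p} \<sigma> \<and> strict_mono_on {p..<p + q} \<sigma>}"

definition select :: "'g list \<Rightarrow> (nat \<Rightarrow> nat) \<Rightarrow> nat \<Rightarrow> nat \<Rightarrow> 'g list" where
  "select xs \<sigma> a b = map (\<lambda>i. xs ! \<sigma> i) [a..<b]"

text \<open>The operations on homogeneous elements: \<open>insertion_hom scale m n\<close> is for
  \<open>P \<in> Hom(\<and>\<^bsup>m+1\<^esup> \<gg>, \<gg>)\<close>, \<open>Q \<in> Hom(\<and>\<^sup>n \<gg>, \<gg>)\<close>; \<open>nr_hom scale m n\<close> is for
  \<open>P \<in> Hom(\<and>\<^bsup>m+1\<^esup> \<gg>, \<gg>)\<close>, \<open>Q \<in> Hom(\<and>\<^bsup>n+1\<^esup> \<gg>, \<gg>)\<close>; \<open>cup_hom scale br m n\<close> is for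
  \<open>P \<in> Hom(\<and>\<^sup>m \<gg>, \<gg>)\<close>, \<open>Q \<in> Hom(\<and>\<^sup>n \<gg>, \<gg>)\<close>.\<close>

definition insertion_hom ::
  "('k::field_char_0 \<Rightarrow> 'g::ab_group_add \<Rightarrow> 'g) \<Rightarrow> nat \<Rightarrow> nat \<Rightarrow>
   ('g list \<Rightarrow> 'g) \<Rightarrow> ('g list \<Rightarrow> 'g) \<Rightarrow> ('g list \<Rightarrow> 'g)" where
  "insertion_hom scale m n P Q = (\<lambda>xs.
     if n = 0 \<or> length xs \<noteq> m + n then 0
     else \<Sum>\<sigma>\<in>shuffle_perms (m + 1) (n - 1).
       scale (of_int (sign \<sigma>)) (Q (P (select xs \<sigma> 0 (m + 1)) # select xs \<sigma> (m + 1) (m + n))))"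

definition nr_hom ::
  "('k::field_char_0 \<Rightarrow> 'g::ab_group_add \<Rightarrow> 'g) \<Rightarrow> nat \<Rightarrow> nat \<Rightarrow>
   ('g list \<Rightarrow> 'g) \<Rightarrow> ('g list \<Rightarrow> 'g) \<Rightarrow> ('g list \<Rightarrow> 'g)" where
  "nr_hom scale m n P Q =
     insertion_hom scale m (n + 1) P Q
     - fun_scale scale ((-1) ^ (m * n)) (insertion_hom scale n (m + 1) Q P)"

definition cup_hom ::
  "('k::field_char_0 \<Rightarrow> 'g::ab_group_add \<Rightarrow> 'g) \<Rightarrow> ('g \<Rightarrow> 'g \<Rightarrow> 'g) \<Rightarrow> nat \<Rightarrow> nat \<Rightarrow>
   ('g list \<Rightarrow> 'g) \<Rightarrow> ('g list \<Rightarrow> 'g) \<Rightarrow> ('g list \<Rightarrow> 'g)" where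
  "cup_hom scale br m n P Q = (\<lambda>xs.
     if length xs \<noteq> m + n then 0
     else \<Sum>\<sigma>\<in>shuffle_perms m n.
       scale (of_int (sign \<sigma>)) (br (P (select xs \<sigma> 0 m)) (Q (select xs \<sigma> m (m + n)))))"

text \<open>
  The bilinear extensions to the direct sums, evaluated at \<open>xs\<close>. A pair of components in
  \<open>Hom(\<and>\<^sup>p \<gg>, \<gg>)\<close> and \<open>Hom(\<and>\<^sup>q \<gg>, \<gg>)\<close> contributes only at one length of \<open>xs\<close>, so the sums are
  finite. \<open>P\<close> and \<open>Q\<close> are evaluated only at lists of the indicated lengths, so no explicit
  projection to homogeneous components is needed; the lemmas below confirm that on homogeneous
  elements the extensions agree with the operations above.
\<close>

definition insertion ::
  "('k::field_char_0 \<Rightarrow> 'g::ab_group_add \<Rightarrow> 'g) \<Rightarrow>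
   ('g list \<Rightarrow> 'g) \<Rightarrow> ('g list \<Rightarrow> 'g) \<Rightarrow> ('g list \<Rightarrow> 'g)" where
  "insertion scale P Q = (\<lambda>xs.
     \<Sum>(m, n) \<in> {(m, n). m + n = length xs}. insertion_hom scale m n P Q xs)"

definition nr_bracket ::
  "('k::field_char_0 \<Rightarrow> 'g::ab_group_add \<Rightarrow> 'g) \<Rightarrow>
   ('g list \<Rightarrow> 'g) \<Rightarrow> ('g list \<Rightarrow> 'g) \<Rightarrow> ('g list \<Rightarrow> 'g)" where
  "nr_bracket scale P Q = (\<lambda>xs.
     \<Sum>(m, n) \<in> {(m, n). m + n + 1 = length xs}. nr_hom scale m n P Q xs)"

definition cup_bracket ::
  "('k::field_char_0 \<Rightarrow> 'g::ab_group_add \<Rightarrow> 'g) \<Rightarrow> ('g \<Rightarrow> 'g \<Rightarrow> 'g) \<Rightarrow>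
   ('g list \<Rightarrow> 'g) \<Rightarrow> ('g list \<Rightarrow> 'g) \<Rightarrow> ('g list \<Rightarrow> 'g)" where
  "cup_bracket scale br P Q = (\<lambda>xs.
     \<Sum>(m, n) \<in> {(m, n). m + n = length xs}. cup_hom scale br m n P Q xs)"

lemma alt_hom_length: "P \<in> alt_hom scale n \<Longrightarrow> length xs \<noteq> n \<Longrightarrow> P xs = 0"
  by (simp add: alt_hom_def)

lemma alt_hom_Cons_0:
  assumes "Q \<in> alt_hom scale n"
  shows "Q (0 # xs) = 0"
proof (cases "length (0 # xs) = n")
  case True
  then have "Vector_Spaces.linear scale scale (\<lambda>x. Q ((0 # xs)[0 := x]))"
    using assms unfolding alt_hom_def by blast
  then have "module_hom scale scale (\<lambda>x. Q (x # xs))"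
    by (simp add: Vector_Spaces.linear_def)
  then show ?thesis
    by (rule module_hom.zero)
qed (simp add: alt_hom_length[OF assms])

lemma length_select [simp]: "length (select xs \<sigma> a b) = b - a"
  by (simp add: select_def)

lemma sum_pairs_single:
  fixes f :: "nat \<Rightarrow> nat \<Rightarrow> 'a::comm_monoid_add"
  assumes "\<And>a b. a + b = N \<Longrightarrow> (a, b) \<noteq> (m, n) \<Longrightarrow> f a b = 0"
    and "m + n \<noteq> N \<Longrightarrow> f m n = 0"
  shows "(\<Sum>(a, b) \<in> {(a, b). a + b = N}. f a b) = f m n"
proof -
  have fin: "finite {(a, b). a + b = (N::nat)}"
    by (rule finite_subset[of _ "{..N} \<times> {..N}"]) auto
  have "(\<Sum>(a, b) \<in> {(a, b). a + b = N}. f a b)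
      = (\<Sum>q \<in> {(a, b). a + b = N}. if q = (m, n) then f m n else 0)"
    using assms(1) by (intro sum.cong) auto
  also have "\<dots> = f m n"
    using fin assms(2) by (auto simp: sum.delta)
  finally show ?thesis .
qed

lemma (in lie_algebra) insertion_hom_other:
  assumes "P \<in> alt_hom scale (m + 1)" "Q \<in> alt_hom scale n" "(a, b) \<noteq> (m, n)"
  shows "insertion_hom scale a b P Q = 0"
proof -
  have "Q (P ys # zs) = 0" if "length ys = a + 1" "length zs + 1 = b" for ys zs
    using assms that alt_hom_length[OF assms(1), of ys] alt_hom_Cons_0[OF assms(2), of zs]
      alt_hom_length[OF assms(2), of "P ys # zs"] by (cases "a = m") auto
  then show ?thesis
    by (auto simp: insertion_hom_def fun_eq_iff intro!: sum.neutral)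
qed

lemma (in lie_algebra) insertion_homogeneous:
  assumes "P \<in> alt_hom scale (m + 1)" "Q \<in> alt_hom scale n"
  shows "insertion scale P Q = insertion_hom scale m n P Q"
proof
  fix xs
  show "insertion scale P Q xs = insertion_hom scale m n P Q xs"
    unfolding insertion_def
  proof (rule sum_pairs_single)
    show "insertion_hom scale a b P Q xs = 0" if "(a, b) \<noteq> (m, n)" for a b
      using insertion_hom_other[OF assms that] by simp
    show "insertion_hom scale m n P Q xs = 0" if "m + n \<noteq> length xs"
      using that by (simp add: insertion_hom_def)
  qed
qed

lemma (in lie_algebra) nr_bracket_homogeneous:
  assumes "P \<in> alt_hom scale (m + 1)" "Q \<in> alt_hom scale (n + 1)"
  shows "nr_bracket scale P Q = nr_hom scale m n P Q"
proof (rule ext)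
  fix xs
  have other: "nr_hom scale a b P Q = 0" if "(a, b) \<noteq> (m, n)" for a b
    using that insertion_hom_other[OF assms, of a "b + 1"]
      insertion_hom_other[OF assms(2,1), of b "a + 1"]
    by (auto simp: nr_hom_def fun_scale_def fun_eq_iff)
  have len: "nr_hom scale m n P Q xs = 0" if "m + n + 1 \<noteq> length xs"
    using that by (auto simp: nr_hom_def insertion_hom_def fun_scale_def)
  show "nr_bracket scale P Q xs = nr_hom scale m n P Q xs"
  proof (cases "length xs")
    case 0
    then show ?thesis using len by (simp add: nr_bracket_def)
  next
    case (Suc N)
    have "(\<Sum>(a, b) \<in> {(a, b). a + b = N}. nr_hom scale a b P Q xs) = nr_hom scale m n P Q xs"
      by (rule sum_pairs_single) (use other len Suc in auto)
    then show ?thesis using Suc by (simp add: nr_bracket_def)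
  qed
qed

lemma (in lie_algebra) cup_bracket_homogeneous:
  assumes "P \<in> alt_hom scale m" "Q \<in> alt_hom scale n"
  shows "cup_bracket scale br P Q = cup_hom scale br m n P Q"
proof -
  have "br 0 y = 0" "br x 0 = 0" for x y
    using br_linear_left[of y] br_linear_right[of x]
    by (auto simp: Vector_Spaces.linear_def dest: module_hom.zero)
  then have other: "cup_hom scale br a b P Q = 0" if "(a, b) \<noteq> (m, n)" for a b
    using that alt_hom_length[OF assms(1)] alt_hom_length[OF assms(2)]
    by (cases "a = m") (auto simp: cup_hom_def fun_eq_iff intro!: sum.neutral)
  show ?thesis
  proof
    fix xs
    show "cup_bracket scale br P Q xs = cup_hom scale br m n P Q xs"
      unfolding cup_bracket_def
    proof (rule sum_pairs_single)
      show "cup_hom scale br a b P Q xs = 0" if "(a, b) \<noteq> (m, n)" for a b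
        using other[OF that] by simp
      show "cup_hom scale br m n P Q xs = 0" if "m + n \<noteq> length xs"
        using that by (simp add: cup_hom_def)
    qed
  qed
qed

end

theory Submission
  imports Defs "Jordan_Normal_Form.Determinant"
begin

text \<open>
  The contraction \<open>P \<mapsto> P(x, \<dots>)\<close> is a graded derivation of degree \<open>-1\<close> both of the cup product and of
  the insertion \<open>(P, Q) \<mapsto> i\<^sub>P Q\<close>, and a map is determined by its value on the empty list together with
  its contractions. Hence every graded identity between iterated products follows by induction on the
  list of arguments: the contraction of the identity is a sum of instances of it with one factor contracted,
  and only the identity at the empty list remains, where it is the skew-symmetry or Jacobi identity of
  the Lie bracket or the skew-symmetry of a single alternating map. Insertion thus satisfies the graded
  pre-Lie identity (elements of \<open>\<gg>\<close> included, in degree \<open>-1\<close>), which gives the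
  Jacobi identity of the Nijenhuis-Richardson bracket and the action property, and it acts by derivations
  of the cup product.
\<close>

section \<open>Shuffle sums as sums over unshuffles of a list\<close>

text \<open>Shuffle sums in a form suited to recursion on the list. Splittings of all sizes are
  summed at once, since the maps involved vanish on lists of the wrong length. A head that joins the
  second part passes all of \<open>ys\<close>, whence the parity test.\<close>

fun unshuffle_sum :: "'a list \<Rightarrow> ('a list \<Rightarrow> 'a list \<Rightarrow> 'b::ab_group_add) \<Rightarrow> 'b" where
  "unshuffle_sum [] F = F [] []"
| "unshuffle_sum (x # xs) F = unshuffle_sum xs (\<lambda>ys zs. F (x # ys) zs)
     + unshuffle_sum xs (\<lambda>ys zs. if even (length ys) then F ys (x # zs) else - F ys (x # zs))"

lemma unshuffle_sum_cong:
  assumes "\<And>ys zs. length ys + length zs = length xs \<Longrightarrow> F ys zs = G ys zs"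
  shows "unshuffle_sum xs F = unshuffle_sum xs G"
  using assms
proof (induction xs arbitrary: F G)
  case (Cons x xs)
  show ?case
    by (simp, intro arg_cong2[where f = "(+)"] Cons.IH) (auto simp: Cons.prems)
qed simp

lemma unshuffle_sum_0 [simp]: "unshuffle_sum xs (\<lambda>ys zs. 0) = 0"
  by (induction xs) (auto cong: if_cong)

lemma unshuffle_sum_hom:
  assumes "\<And>a b. f (a + b) = f a + f b"
  shows "unshuffle_sum xs (\<lambda>ys zs. f (F ys zs)) = f (unshuffle_sum xs F)"
proof -
  have "f 0 = 0"
    using assms[of 0 0] by simp
  then have uminus: "f (- a) = - f a" for a
    using assms[of a "- a"] by (simp add: eq_neg_iff_add_eq_0 add.commute)
  show ?thesis
    by (induction xs arbitrary: F) (auto simp: assms uminus[symmetric] if_distrib[of f, symmetric] cong: if_cong)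
qed

lemma unshuffle_sum_add:
  "unshuffle_sum xs (\<lambda>ys zs. F ys zs + G ys zs) = unshuffle_sum xs F + unshuffle_sum xs G"
proof (induction xs arbitrary: F G)
  case (Cons x xs)
  have "(\<lambda>ys zs. if even (length ys) then F ys (x # zs) + G ys (x # zs)
         else - (F ys (x # zs) + G ys (x # zs)))
      = (\<lambda>ys zs. (if even (length ys) then F ys (x # zs) else - F ys (x # zs))
           + (if even (length ys) then G ys (x # zs) else - G ys (x # zs)))"
    by (intro ext) simp
  then show ?case
    by (simp add: Cons.IH algebra_simps)
qed simp

section \<open>Shuffles according to the position of the value 0\<close>

lemma permutation_insert_shuffle_iff:
  assumes p: "\<tau> permutes {..<a + b}"
  shows "permutation_insert 0 0 \<tau> \<in> shuffle_perms (Suc a) b \<longleftrightarrow> \<tau> \<in> shuffle_perms a b"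
    and "permutation_insert a 0 \<tau> \<in> shuffle_perms a (Suc b) \<longleftrightarrow> \<tau> \<in> shuffle_perms a b"
proof -
  have perm: "permutation_insert i 0 \<tau> permutes {..<Suc (a + b)}" if "i \<le> a" for i
    using permutation_insert_permutes[of \<tau> "a + b" i 0] p that
    by (simp add: lessThan_atLeast0)
  \<comment> \<open>\<open>permutation_insert c 0 \<tau>\<close> sends \<open>c\<close> to 0 and
    raises all other values by one. As 0 is the least value and stands first in this block,
    monotonicity carries over both ways. Needed for \<open>c = 0\<close> and
    \<open>c = a\<close>.\<close>
  have ins: "strict_mono_on {c..<c + Suc d} (permutation_insert c 0 \<tau>)
      \<longleftrightarrow> strict_mono_on {c..<c + d} \<tau>" for c d
  proof
    assume L: "strict_mono_on {c..<c + Suc d} (permutation_insert c 0 \<tau>)"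
    show "strict_mono_on {c..<c + d} \<tau>"
    proof (rule strict_mono_onI)
      fix r s assume "r \<in> {c..<c + d}" "s \<in> {c..<c + d}" "r < s"
      then show "\<tau> r < \<tau> s"
        using strict_mono_onD[OF L, of "Suc r" "Suc s"] by (simp add: permutation_insert_expand)
    qed
  next
    assume R: "strict_mono_on {c..<c + d} \<tau>"
    show "strict_mono_on {c..<c + Suc d} (permutation_insert c 0 \<tau>)"
    proof (rule strict_mono_onI)
      fix r s assume "r \<in> {c..<c + Suc d}" "s \<in> {c..<c + Suc d}" "r < s"
      then show "permutation_insert c 0 \<tau> r < permutation_insert c 0 \<tau> s"
        using strict_mono_onD[OF R, of "r - 1" "s - 1"] by (auto simp: permutation_insert_expand)
    qed
  qed
  have 1: "strict_mono_on {..<Suc a} (permutation_insert 0 0 \<tau>) \<longleftrightarrow> strict_mono_on {..<a} \<tau>"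
    using ins[of 0 a] by (simp add: lessThan_atLeast0)
  \<comment> \<open>Here the insertion lies to the left of the block, so positions and values are
    merely shifted by one.\<close>
  have 2: "strict_mono_on {Suc a..<Suc a + b} (permutation_insert 0 0 \<tau>)
      \<longleftrightarrow> strict_mono_on {a..<a + b} \<tau>"
  proof
    assume L: "strict_mono_on {Suc a..<Suc a + b} (permutation_insert 0 0 \<tau>)"
    show "strict_mono_on {a..<a + b} \<tau>"
    proof (rule strict_mono_onI)
      fix r s assume "r \<in> {a..<a + b}" "s \<in> {a..<a + b}" "r < s"
      then show "\<tau> r < \<tau> s"
        using strict_mono_onD[OF L, of "Suc r" "Suc s"] by (simp add: permutation_insert_expand)
    qed
  next
    assume R: "strict_mono_on {a..<a + b} \<tau>"
    show "strict_mono_on {Suc a..<Suc a + b} (permutation_insert 0 0 \<tau>)"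
    proof (rule strict_mono_onI)
      fix r s assume "r \<in> {Suc a..<Suc a + b}" "s \<in> {Suc a..<Suc a + b}" "r < s"
      then show "permutation_insert 0 0 \<tau> r < permutation_insert 0 0 \<tau> s"
        using strict_mono_onD[OF R, of "r - 1" "s - 1"] by (auto simp: permutation_insert_expand)
    qed
  qed
  have 3: "strict_mono_on {..<a} (permutation_insert a 0 \<tau>) \<longleftrightarrow> strict_mono_on {..<a} \<tau>"
    by (simp add: strict_mono_on_def permutation_insert_expand)
  note 4 = ins[of a b]
  show "permutation_insert 0 0 \<tau> \<in> shuffle_perms (Suc a) b \<longleftrightarrow> \<tau> \<in> shuffle_perms a b"
    using perm[of 0] p 1 2 by (simp add: shuffle_perms_def)
  show "permutation_insert a 0 \<tau> \<in> shuffle_perms a (Suc b) \<longleftrightarrow> \<tau> \<in> shuffle_perms a b"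
    using perm[of a] p 3 4 by (simp add: shuffle_perms_def)
qed

lemma shuffle_perms_fix:
  "{\<sigma> \<in> shuffle_perms (Suc a) b. \<sigma> 0 = 0} = permutation_insert 0 0 ` shuffle_perms a b"
  "{\<sigma> \<in> shuffle_perms a (Suc b). \<sigma> a = 0} = permutation_insert a 0 ` shuffle_perms a b"
proof -
  have sub: "shuffle_perms a b \<subseteq> {\<tau>. \<tau> permutes {..<a + b}}" for a b
    by (auto simp: shuffle_perms_def)
  \<comment> \<open>Every permutation with \<open>\<sigma> i = 0\<close> arises by such an
    insertion, so only membership in the shuffle sets has to be compared.\<close>
  note fix0 = permutation_fix[of _ "a + b" 0, folded lessThan_atLeast0]
  have *: "{\<sigma> \<in> S'. \<sigma> i = 0} = permutation_insert i 0 ` S"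
    if "i \<le> a" "S' \<subseteq> {\<tau>. \<tau> permutes {..<Suc (a + b)}}" "S \<subseteq> {\<tau>. \<tau> permutes {..<a + b}}"
      and "\<And>\<tau>. \<tau> permutes {..<a + b} \<Longrightarrow> permutation_insert i 0 \<tau> \<in> S' \<longleftrightarrow> \<tau> \<in> S"
    for i S S'
  proof -
    have "{\<sigma> \<in> S'. \<sigma> i = 0} = S' \<inter> {\<sigma>. \<sigma> permutes {..<Suc (a + b)} \<and> \<sigma> i = 0}"
      using that(2) by auto
    also have "\<dots> = S' \<inter> permutation_insert i 0 ` {\<tau>. \<tau> permutes {..<a + b}}"
      using fix0[of i] that(1) by simp
    also have "\<dots> = permutation_insert i 0 ` S"
      using that(3,4) by auto
    finally show ?thesis .
  qed
  show "{\<sigma> \<in> shuffle_perms (Suc a) b. \<sigma> 0 = 0} = permutation_insert 0 0 ` shuffle_perms a b"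
    using sub[of "Suc a" b] sub[of a b] by (intro *) (auto simp: permutation_insert_shuffle_iff)
  show "{\<sigma> \<in> shuffle_perms a (Suc b). \<sigma> a = 0} = permutation_insert a 0 ` shuffle_perms a b"
    using sub[of a "Suc b"] sub[of a b] by (intro *) (auto simp: permutation_insert_shuffle_iff)
qed

text \<open>A shuffle increases on each block, so the least value can only stand first in its
  block.\<close>

lemma shuffle_perms_hits_0:
  assumes "\<sigma> \<in> shuffle_perms a b" "0 < a + b"
  shows "0 < a \<and> \<sigma> 0 = 0 \<or> 0 < b \<and> \<sigma> a = 0"
proof -
  from assms have s: "\<sigma> permutes {..<a + b}" "strict_mono_on {..<a} \<sigma>"
    "strict_mono_on {a..<a + b} \<sigma>"
    by (auto simp: shuffle_perms_def)
  from permutes_image[OF s(1)] assms(2) obtain i where i: "i < a + b" "\<sigma> i = 0"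
    by (metis imageE lessThan_iff)
  show ?thesis
  proof (cases "i < a")
    case True
    then have "i = 0"
      using strict_mono_onD[OF s(2), of 0 i] i by fastforce
    with True i show ?thesis by simp
  next
    case False
    then have "i = a"
      using strict_mono_onD[OF s(3), of a i] i by fastforce
    with False i show ?thesis by simp
  qed
qed

lemma finite_shuffle_perms: "finite (shuffle_perms a b)"
  by (rule finite_subset[of _ "{\<sigma>. \<sigma> permutes {..<a + b}}"])
    (auto simp: shuffle_perms_def finite_permutations)

text \<open>A Pascal recursion: the value 0, which selects the head of the argument list, starts
  either the left or the right block. The guards keep truncated subtraction from counting shuffles
  of an empty block.\<close>

lemma sum_shuffle_perms_split:
  assumes "0 < a + b"
  shows "sum f (shuffle_perms a b)
    = (if a = 0 then 0 else \<Sum>\<tau>\<in>shuffle_perms (a - 1) b. f (permutation_insert 0 0 \<tau>))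
    + (if b = 0 then 0 else \<Sum>\<tau>\<in>shuffle_perms a (b - 1). f (permutation_insert a 0 \<tau>))"
proof -
  let ?A = "{\<sigma> \<in> shuffle_perms a b. 0 < a \<and> \<sigma> 0 = 0}"
  let ?B = "{\<sigma> \<in> shuffle_perms a b. 0 < b \<and> \<sigma> a = 0}"
  have inj: "inj_on (permutation_insert i 0) (shuffle_perms c d)" if "i \<le> c + d" for i c d
    by (rule inj_on_subset[OF permutation_insert_inj_on[of i "c + d" 0]])
      (use that in \<open>auto simp: shuffle_perms_def lessThan_atLeast0\<close>)
  have "shuffle_perms a b = ?A \<union> ?B"
    using shuffle_perms_hits_0[OF _ assms] by blast
  \<comment> \<open>A common element would satisfy \<open>\<sigma> 0 = \<sigma> a\<close> with
    \<open>0 < a\<close>, against injectivity.\<close>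
  moreover have "?A \<inter> ?B = {}"
  proof (rule equals0I)
    fix \<sigma> assume "\<sigma> \<in> ?A \<inter> ?B"
    then show False
      using permutes_inj[of \<sigma> "{..<a + b}"] by (auto simp: shuffle_perms_def dest: injD[of \<sigma> 0 a])
  qed
  ultimately have "sum f (shuffle_perms a b) = sum f ?A + sum f ?B"
    using finite_shuffle_perms[of a b] by (metis (lifting) finite_Un sum.union_disjoint)
  moreover have "sum f ?A = (if a = 0 then 0
      else \<Sum>\<tau>\<in>shuffle_perms (a - 1) b. f (permutation_insert 0 0 \<tau>))"
    using shuffle_perms_fix(1)[of "a - 1" b] inj[of 0 "a - 1" b]
    by (cases a) (simp_all add: sum.reindex)
  moreover have "sum f ?B = (if b = 0 then 0
      else \<Sum>\<tau>\<in>shuffle_perms a (b - 1). f (permutation_insert a 0 \<tau>))"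
    using shuffle_perms_fix(2)[of a "b - 1"] inj[of a a "b - 1"]
    by (cases b) (simp_all add: sum.reindex)
  ultimately show ?thesis by simp
qed

lemma shuffle_perms_0_0: "shuffle_perms 0 0 = {id}"
  by (auto simp: shuffle_perms_def strict_mono_on_def)

text \<open>The inserted value 0 picks the head \<open>x\<close>; the raised values read the same
  entries of \<open>xs\<close> as before.\<close>

lemma select_permutation_insert:
  assumes "\<tau> permutes {..<a + b}" "length xs = a + b"
  shows "select (x # xs) (permutation_insert 0 0 \<tau>) 0 (Suc a) = x # select xs \<tau> 0 a"
    and "select (x # xs) (permutation_insert 0 0 \<tau>) (Suc a) (Suc (a + b)) = select xs \<tau> a (a + b)"
    and "select (x # xs) (permutation_insert a 0 \<tau>) 0 a = select xs \<tau> 0 a"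
    and "select (x # xs) (permutation_insert a 0 \<tau>) a (Suc (a + b)) = x # select xs \<tau> a (a + b)"
  unfolding select_def permutation_insert_expand
  by (auto intro!: nth_equalityI simp: nth_Cons' simp del: upt_Suc)

text \<open>Passage from permutation sums to the recursive sum, by induction on \<open>xs\<close>
  with a split on the block receiving the head. \<open>F\<close> is kept general so that it can
  absorb the head and its sign.\<close>

lemma (in vector_space) sum_shuffle_perms_select:
  assumes "length xs = p + q"
  shows "(\<Sum>\<sigma>\<in>shuffle_perms p q.
      scale (of_int (sign \<sigma>)) (F (select xs \<sigma> 0 p) (select xs \<sigma> p (p + q))))
    = unshuffle_sum xs (\<lambda>ys zs. if length ys = p then F ys zs else 0)"
  using assms
proof (induction xs arbitrary: p q F)
  case Nil
  then show ?case by (simp add: shuffle_perms_0_0 select_def)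
next
  case (Cons x xs)
  let ?f = "\<lambda>\<sigma>. scale (of_int (sign \<sigma>)) (F (select (x # xs) \<sigma> 0 p) (select (x # xs) \<sigma> p (p + q)))"
  \<comment> \<open>Inserting the value 0 at position \<open>i\<close> creates \<open>i\<close> new
    inversions.\<close>
  have sign: "of_int (sign (permutation_insert i 0 \<tau>)) = (-1) ^ i * (of_int (sign \<tau>) :: 'a)"
    if "\<tau> \<in> shuffle_perms a b" "i \<le> a + b" for i \<tau> a b
    using signof_permutation_insert[of \<tau> "a + b" i 0] that
    by (simp add: shuffle_perms_def lessThan_atLeast0)
  have A: "(if p = 0 then 0 else \<Sum>\<tau>\<in>shuffle_perms (p - 1) q. ?f (permutation_insert 0 0 \<tau>))
    = unshuffle_sum xs (\<lambda>ys zs. if length (x # ys) = p then F (x # ys) zs else 0)"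
  proof (cases p)
    case (Suc a)
    have "(\<Sum>\<tau>\<in>shuffle_perms a q. ?f (permutation_insert 0 0 \<tau>))
      = (\<Sum>\<tau>\<in>shuffle_perms a q. scale (of_int (sign \<tau>))
           (F (x # select xs \<tau> 0 a) (select xs \<tau> a (a + q))))"
      using Cons.prems Suc
      by (intro sum.cong refl) (simp add: sign select_permutation_insert[of _ a q] shuffle_perms_def)
    then show ?thesis
      using Cons.IH[of a q "\<lambda>ys. F (x # ys)"] Cons.prems Suc by simp
  qed simp
  have B: "(if q = 0 then 0 else \<Sum>\<tau>\<in>shuffle_perms p (q - 1). ?f (permutation_insert p 0 \<tau>))
    = unshuffle_sum xs (\<lambda>ys zs. if even (length ys)
        then (if length ys = p then F ys (x # zs) else 0)
        else - (if length ys = p then F ys (x # zs) else 0))"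
  proof (cases q)
    case 0
    \<comment> \<open>For \<open>q = 0\<close> the list \<open>xs\<close> has only
      \<open>p - 1\<close> entries, so \<open>length ys = p\<close> never occurs.\<close>
    have "unshuffle_sum xs (\<lambda>ys zs. if even (length ys)
        then (if length ys = p then F ys (x # zs) else 0)
        else - (if length ys = p then F ys (x # zs) else 0)) = unshuffle_sum xs (\<lambda>ys zs. 0)"
      by (rule unshuffle_sum_cong) (use 0 Cons.prems in auto)
    with 0 show ?thesis by simp
  next
    case (Suc b)
    have "(\<Sum>\<tau>\<in>shuffle_perms p b. ?f (permutation_insert p 0 \<tau>))
      = (\<Sum>\<tau>\<in>shuffle_perms p b. scale (of_int (sign \<tau>))
           (scale ((-1) ^ p) (F (select xs \<tau> 0 p) (x # select xs \<tau> p (p + b)))))"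
      using Cons.prems Suc
      by (intro sum.cong refl)
        (simp add: sign select_permutation_insert[of _ p b] shuffle_perms_def mult.commute)
    also have "\<dots> = unshuffle_sum xs (\<lambda>ys zs.
        if length ys = p then scale ((-1) ^ p) (F ys (x # zs)) else 0)"
      using Cons.IH[of p b "\<lambda>ys zs. scale ((-1) ^ p) (F ys (x # zs))"] Cons.prems Suc by simp
    also have "\<dots> = unshuffle_sum xs (\<lambda>ys zs. if even (length ys)
        then (if length ys = p then F ys (x # zs) else 0)
        else - (if length ys = p then F ys (x # zs) else 0))"
      by (rule unshuffle_sum_cong) (auto simp: uminus_power_if)
    finally show ?thesis using Suc by simp
  qed
  have "0 < p + q" using Cons.prems by (metis length_Cons zero_less_Suc)
  from sum_shuffle_perms_split[OF this, of ?f] A B show ?case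
    by simp
qed

section \<open>Alternating maps and contractions\<close>

text \<open>The sign (-1)^i as a parity test on an integer exponent: degrees may drop to -1, and
  sign identities reduce to cases on parities.\<close>

definition signed :: "int \<Rightarrow> 'a::ab_group_add \<Rightarrow> 'a" where
  "signed i a = (if even i then a else - a)"

lemma signed_apply: "signed i f x = signed i (f x)"
  by (simp add: signed_def)

lemma (in vector_space) scale_powi_eq_signed: "scale ((-1) powi i) a = signed i a"
  by (simp add: signed_def power_int_minus_left)

text \<open>The interior product with \<open>x\<close>. It is defined for all functions on lists, so
  it applies to a product before that is known to be alternating.\<close>

definition contract :: "'a \<Rightarrow> ('a list \<Rightarrow> 'b) \<Rightarrow> 'a list \<Rightarrow> 'b" where
  "contract x P = (\<lambda>xs. P (x # xs))"

lemma contract_linear_ops: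
  "contract x (P + Q) = contract x P + contract x Q"
  "contract x (- P) = - contract x P"
  "contract x 0 = 0"
  by (auto simp: contract_def)

text \<open>Polarisation: expand \<open>f (x + y) (x + y) = 0\<close>.\<close>

lemma biadditive_skew:
  fixes f :: "'a::ab_group_add \<Rightarrow> 'a \<Rightarrow> 'b::ab_group_add"
  assumes "\<And>x y z. f (x + y) z = f x z + f y z" "\<And>x y z. f z (x + y) = f z x + f z y"
    and "\<And>x. f x x = 0"
  shows "f x y = - f y x"
  using assms(3)[of "x + y"] unfolding assms(1,2)
  by (simp add: assms(3) eq_neg_iff_add_eq_0 add.commute)

text \<open>Insertion and the Nijenhuis-Richardson bracket live on a bare vector space; the Lie
  bracket enters only with the cup product.\<close>

locale vector_space_char_0 = vector_space scale
  for scale :: "'k::field_char_0 \<Rightarrow> 'g::ab_group_add \<Rightarrow> 'g"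
begin

text \<open>Degrees range over the integers, with the zero space below 0, so that contraction lowers
  the degree by one without exception.\<close>

abbreviation alts :: "int \<Rightarrow> ('g list \<Rightarrow> 'g) set" where
  "alts \<equiv> nonneg_graded (alt_hom scale)"

lemma linear_scale_iff:
  "Vector_Spaces.linear scale scale f \<longleftrightarrow> (\<forall>x y. f (x + y) = f x + f y) \<and> (\<forall>c x. f (scale c x) = scale c (f x))"
  using vector_space_axioms by (simp add: Vector_Spaces.linear_iff)

lemma alt_hom_linear:
  assumes "P \<in> alt_hom scale n"
  shows "Vector_Spaces.linear scale scale (\<lambda>x. P (x # zs))"
proof (cases "length (0 # zs) = n")
  case True
  then have "Vector_Spaces.linear scale scale (\<lambda>x. P ((0 # zs)[0 := x]))"
    using assms unfolding alt_hom_def by blast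
  then show ?thesis by simp
next
  case False
  then show ?thesis
    using alt_hom_length[OF assms] by (auto simp: linear_scale_iff)
qed

lemma alt_hom_repeat:
  assumes "P \<in> alt_hom scale n"
  shows "P (x # x # zs) = 0"
proof (cases "length (x # x # zs) = n")
  case True
  have "\<forall>xs i j. length xs = n \<longrightarrow> i < n \<longrightarrow> j < n \<longrightarrow> i \<noteq> j \<longrightarrow> xs ! i = xs ! j \<longrightarrow> P xs = 0"
    using assms by (simp add: alt_hom_def)
  from this[rule_format, of "x # x # zs" 0 1] True show ?thesis by auto
qed (simp add: alt_hom_length[OF assms])

lemma alt_hom_contract:
  assumes "P \<in> alt_hom scale (Suc n)"
  shows "contract x P \<in> alt_hom scale n"
proof -
  have lin: "Vector_Spaces.linear scale scale (\<lambda>y. P (xs[i := y]))" if "length xs = Suc n" "i < Suc n" for xs i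
    using assms that by (simp add: alt_hom_def)
  have alt: "P xs = 0" if "length xs = Suc n" "i < Suc n" "j < Suc n" "i \<noteq> j" "xs ! i = xs ! j" for xs i j
    using assms that unfolding alt_hom_def by blast
  show ?thesis
    unfolding alt_hom_def contract_def
  proof (intro CollectI conjI allI impI)
    show "P (x # xs) = 0" if "length xs \<noteq> n" for xs
      using alt_hom_length[OF assms] that by simp
    show "Vector_Spaces.linear scale scale (\<lambda>y. P (x # xs[i := y]))" if "length xs = n" "i < n" for xs i
      using lin[of "x # xs" "Suc i"] that by simp
    show "P (x # xs) = 0" if "length xs = n" "i < n" "j < n" "i \<noteq> j" "xs ! i = xs ! j" for xs i j
      using alt[of "x # xs" "Suc i" "Suc j"] that by simp
  qed
qed

text \<open>Repetitions avoiding the first slot are left to the contractions; one involving it is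
  reduced to these by swapping the first two arguments.\<close>

lemma alt_hom_SucI:
  assumes Nil: "P [] = 0"
    and contract: "\<And>x. contract x P \<in> alt_hom scale n"
    and linear: "\<And>zs. Vector_Spaces.linear scale scale (\<lambda>x. P (x # zs))"
    and repeat: "\<And>x zs. P (x # x # zs) = 0"
  shows "P \<in> alt_hom scale (Suc n)"
proof -
  have swap: "P (x # y # zs) = - P (y # x # zs)" for x y zs
    using linear alt_hom_linear[OF contract, of _ zs] repeat
    by (intro biadditive_skew[of "\<lambda>x y. P (x # y # zs)"]) (simp_all add: linear_scale_iff contract_def)
  have tail: "P (x # ys) = 0" if "length ys = n" "i < n" "j < n" "i \<noteq> j" "ys ! i = ys ! j" for x ys i j
    using contract[of x] that unfolding alt_hom_def contract_def by blast
  have head: "P (x # ys) = 0" if "length ys = n" "k < n" "ys ! k = x" for x ys k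
  proof (cases k)
    case 0
    with that show ?thesis by (cases ys) (auto simp: repeat)
  next
    case (Suc l)
    \<comment> \<open>Exchanging \<open>x\<close> with its neighbour \<open>y\<close> puts both
      copies of \<open>x\<close> behind the first slot.\<close>
    with that obtain y zs where "ys = y # zs" by (cases ys) auto
    with that Suc show ?thesis
      using tail[of "x # zs" 0 k y] by (simp add: swap[of x y])
  qed
  show ?thesis
    unfolding alt_hom_def
  proof (intro CollectI conjI allI impI)
    show "P xs = 0" if "length xs \<noteq> Suc n" for xs
    proof (cases xs)
      case (Cons y ys)
      with that show ?thesis
        using alt_hom_length[OF contract[of y], of ys] by (simp add: contract_def)
    qed (simp add: Nil)
    show "Vector_Spaces.linear scale scale (\<lambda>x. P (xs[i := x]))" if "length xs = Suc n" "i < Suc n" for xs i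
    proof -
      from that obtain y ys where xs: "xs = y # ys" by (cases xs) auto
      show ?thesis
      proof (cases i)
        case 0
        with linear xs show ?thesis by simp
      next
        case (Suc j)
        with that xs contract[of y] show ?thesis
          by (simp add: alt_hom_def contract_def)
      qed
    qed
    show "P xs = 0"
      if "length xs = Suc n" "i < Suc n" "j < Suc n" "i \<noteq> j" "xs ! i = xs ! j" for xs i j
    proof -
      from that obtain y ys where xs: "xs = y # ys" by (cases xs) auto
      with that show ?thesis
        using tail[of ys "i - 1" "j - 1" y] head[of ys "i - 1" y] head[of ys "j - 1" y]
        by (cases i; cases j) auto
    qed
  qed
qed

lemma alts_length: "P \<in> alts i \<Longrightarrow> int (length xs) \<noteq> i \<Longrightarrow> P xs = 0"
  using alt_hom_length[of P scale "nat i" xs] by (auto simp: nonneg_graded_def split: if_splits)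

lemma alts_neg: "P \<in> alts i \<Longrightarrow> i < 0 \<Longrightarrow> P = 0"
  by (simp add: nonneg_graded_def)

lemma zero_alt_hom: "0 \<in> alt_hom scale n"
  by (simp add: alt_hom_def linear_scale_iff)

lemma zero_alts: "0 \<in> alts i"
  by (simp add: nonneg_graded_def zero_alt_hom)

lemma alt_hom_add: "P \<in> alt_hom scale n \<Longrightarrow> Q \<in> alt_hom scale n \<Longrightarrow> P + Q \<in> alt_hom scale n"
  unfolding alt_hom_def linear_scale_iff
  by (auto simp: algebra_simps)

lemma alt_hom_fun_scale: "P \<in> alt_hom scale n \<Longrightarrow> fun_scale scale c P \<in> alt_hom scale n"
  unfolding alt_hom_def linear_scale_iff fun_scale_def
  by (auto simp: algebra_simps)

lemma alts_add: "P \<in> alts i \<Longrightarrow> Q \<in> alts i \<Longrightarrow> P + Q \<in> alts i"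
  by (auto simp: nonneg_graded_def alt_hom_add split: if_splits)

lemma fun_scale_0: "fun_scale scale c 0 = 0"
  by (auto simp: fun_scale_def)

lemma alts_fun_scale: "P \<in> alts i \<Longrightarrow> fun_scale scale c P \<in> alts i"
  by (auto simp: nonneg_graded_def alt_hom_fun_scale fun_scale_0 split: if_splits)

lemma alts_uminus: "P \<in> alts i \<Longrightarrow> - P \<in> alts i"
  using alts_fun_scale[of P i "- 1"] by (simp add: fun_scale_def fun_Compl_def)

lemma alts_signed: "P \<in> alts i \<Longrightarrow> signed k P \<in> alts i"
  by (simp add: signed_def alts_uminus)

lemma alts_linear: "P \<in> alts i \<Longrightarrow> Vector_Spaces.linear scale scale (\<lambda>x. P (x # zs))"
  using alt_hom_linear by (fastforce simp: nonneg_graded_def linear_scale_iff split: if_splits)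

lemma alts_Cons_add: "P \<in> alts i \<Longrightarrow> P ((x + y) # zs) = P (x # zs) + P (y # zs)"
  and alts_Cons_scale: "P \<in> alts i \<Longrightarrow> P (scale c x # zs) = scale c (P (x # zs))"
  using alts_linear[of P i zs] by (simp_all add: linear_scale_iff)

lemma alts_Cons_0: "P \<in> alts i \<Longrightarrow> P (0 # zs) = 0"
  using alts_Cons_add[of P i 0 0 zs] by simp

lemma alts_Cons_uminus: "P \<in> alts i \<Longrightarrow> P (- x # zs) = - P (x # zs)"
  using alts_Cons_scale[of P i "- 1" x zs] by simp

lemma alts_repeat: "P \<in> alts i \<Longrightarrow> P (x # x # zs) = 0"
  by (auto simp: nonneg_graded_def alt_hom_repeat split: if_splits)

lemma alts_contract: "P \<in> alts i \<Longrightarrow> contract x P \<in> alts (i - 1)"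
proof (cases "0 < i")
  case True
  assume "P \<in> alts i"
  with True show ?thesis
    using alt_hom_contract[of P "nat (i - 1)" x] by (simp add: nonneg_graded_def Suc_nat_eq_nat_zadd1)
next
  case False
  assume "P \<in> alts i"
  with False have "contract x P = 0"
    using alts_length[of P i] by (auto simp: contract_def)
  then show ?thesis by (simp add: zero_alts)
qed

lemma alts_swap:
  assumes "P \<in> alts i"
  shows "P (x # y # zs) = - P (y # x # zs)"
  using alts_Cons_add[OF assms] alts_Cons_add[OF alts_contract[OF assms], of _ _ _ zs] alts_repeat[OF assms]
  by (intro biadditive_skew[of "\<lambda>x y. P (x # y # zs)"]) (simp_all add: contract_def)

lemma altsI:
  assumes "i \<noteq> 0 \<Longrightarrow> P [] = 0"
    and "\<And>x. contract x P \<in> alts (i - 1)"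
    and "\<And>zs. Vector_Spaces.linear scale scale (\<lambda>x. P (x # zs))"
    and "\<And>x zs. P (x # x # zs) = 0"
  shows "P \<in> alts i"
proof (cases "0 < i")
  case True
  with assms(2) have "contract x P \<in> alt_hom scale (nat (i - 1))" for x
    by (simp add: nonneg_graded_def)
  moreover have "nat i = Suc (nat (i - 1))"
    using True by simp
  ultimately show ?thesis
    using True assms alt_hom_SucI[of P "nat (i - 1)"] by (simp add: nonneg_graded_def)
next
  case False
  \<comment> \<open>The contractions have negative degree, so \<open>P\<close> is concentrated on
    the empty list and, for \<open>i < 0\<close>, vanishes there too.\<close>
  then have "contract x P = 0" for x
    using alts_neg[OF assms(2)] by simp
  then have *: "P (x # xs) = 0" for x xs
    by (metis contract_def zero_fun_apply)
  have "P xs = 0" if "xs \<noteq> []" for xs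
    using that * by (cases xs) auto
  moreover have "P = 0" if "i \<noteq> 0"
    using assms(1)[OF that] * by (intro ext) (metis neq_Nil_conv zero_fun_apply)
  ultimately show ?thesis
    using False by (auto simp: nonneg_graded_def alt_hom_def)
qed

lemma alts_contract_add: "P \<in> alts i \<Longrightarrow> contract (x + y) P = contract x P + contract y P"
  by (auto simp: contract_def alts_Cons_add)

lemma alts_contract_scale: "P \<in> alts i \<Longrightarrow> contract (scale c x) P = fun_scale scale c (contract x P)"
  by (auto simp: contract_def fun_scale_def alts_Cons_scale)

lemma alts_contract_contract: "P \<in> alts i \<Longrightarrow> contract x (contract x P) = 0"
  by (auto simp: contract_def alts_repeat)

text \<open>Contracting a product gives products with one factor of lower degree, so alternation
  follows by induction from bilinearity and the derivation rule. Applied with \<open>d = 1\<close>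
  to insertion and with \<open>d = 0\<close> to the cup product.\<close>

lemma alts_product:
  assumes add1: "\<And>i j P P' Q. P \<in> alts i \<Longrightarrow> P' \<in> alts i \<Longrightarrow> Q \<in> alts j \<Longrightarrow> B (P + P') Q = B P Q + B P' Q"
    and add2: "\<And>i j P Q Q'. P \<in> alts i \<Longrightarrow> Q \<in> alts j \<Longrightarrow> Q' \<in> alts j \<Longrightarrow> B P (Q + Q') = B P Q + B P Q'"
    and scale1: "\<And>i j P Q c. P \<in> alts i \<Longrightarrow> Q \<in> alts j \<Longrightarrow>
      B (fun_scale scale c P) Q = fun_scale scale c (B P Q)"
    and scale2: "\<And>i j P Q c. P \<in> alts i \<Longrightarrow> Q \<in> alts j \<Longrightarrow>
      B P (fun_scale scale c Q) = fun_scale scale c (B P Q)"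
    and derivation: "\<And>i j P Q x. P \<in> alts i \<Longrightarrow> Q \<in> alts j \<Longrightarrow>
      contract x (B P Q) = B (contract x P) Q + signed (i + d) (B P (contract x Q))"
    and Nil: "\<And>i j P Q. P \<in> alts i \<Longrightarrow> Q \<in> alts j \<Longrightarrow> i + j \<noteq> d \<Longrightarrow> B P Q [] = 0"
    and "P \<in> alts i" "Q \<in> alts j"
  shows "B P Q \<in> alts (i + j - d)"
  using assms(7-)
\<comment> \<open>The shift by one makes the measure drop even when a factor of degree 0 is
  contracted to degree -1.\<close>
proof (induction "nat (i + 1) + nat (j + 1)" arbitrary: i j P Q rule: less_induct)
  case less
  note P = less.prems(1) and Q = less.prems(2)
  have fun_scale_scalar_0: "fun_scale scale 0 R = 0" for R
    by (auto simp: fun_scale_def)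
  have B0: "B 0 R = 0" "B R 0 = 0" if "R \<in> alts k" for R k
    using scale1[OF zero_alts that, of 0] scale2[OF that zero_alts, of 0] by (simp_all add: fun_scale_scalar_0)
  consider "i < 0" | "j < 0" | "0 \<le> i" "0 \<le> j" by linarith
  then show ?case
  proof cases
    case 1
    with B0(1)[OF Q] show ?thesis by (simp add: alts_neg[OF P] zero_alts)
  next
    case 2
    with B0(2)[OF P] show ?thesis by (simp add: alts_neg[OF Q] zero_alts)
  next
    case 3
    have contract_Cons: "B P Q (x # zs) = B (contract x P) Q zs + signed (i + d) (B P (contract x Q) zs)" for x zs
      using fun_cong[OF derivation[OF P Q, of x], of zs] by (simp add: contract_def signed_apply)
    note Px = alts_contract[OF P] and Qx = alts_contract[OF Q]
    show ?thesis
    proof (rule altsI)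
      show "B P Q [] = 0" if "i + j - d \<noteq> 0"
        using Nil[OF P Q] that by simp
      show "contract x (B P Q) \<in> alts (i + j - d - 1)" for x
      proof -
        have "B (contract x P) Q \<in> alts (i - 1 + j - d)"
          by (rule less.hyps[OF _ Px Q]) (use 3 in simp)
        moreover have "B P (contract x Q) \<in> alts (i + (j - 1) - d)"
          by (rule less.hyps[OF _ P Qx]) (use 3 in simp)
        ultimately show ?thesis
          unfolding derivation[OF P Q]
          by (intro alts_add alts_signed) (simp_all add: algebra_simps)
      qed
      show "Vector_Spaces.linear scale scale (\<lambda>x. B P Q (x # zs))" for zs
        unfolding linear_scale_iff contract_Cons alts_contract_add[OF P] alts_contract_add[OF Q]
          alts_contract_scale[OF P] alts_contract_scale[OF Q]
          add1[OF Px Px Q] add2[OF P Qx Qx] scale1[OF Px Q] scale2[OF P Qx]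
        by (simp add: fun_scale_def signed_def scale_right_distrib algebra_simps)
      show "B P Q (x # x # zs) = 0" for x zs
      proof -
        \<comment> \<open>Only the two mixed terms survive; their signs, with exponents
          \<open>i - 1 + d\<close> and \<open>i + d\<close>, are opposite.\<close>
        have "contract x (contract x (B P Q)) = 0"
          using derivation[OF P Q, of x] derivation[OF Px Q, of x x] derivation[OF P Qx, of x x]
          by (auto simp: alts_contract_contract[OF P] alts_contract_contract[OF Q] B0[OF Q] B0[OF P]
            contract_linear_ops signed_def)
        from fun_cong[OF this, of zs] show ?thesis by (simp add: contract_def)
      qed
    qed
  qed
qed

end

section \<open>Insertion and cup product\<close>

sublocale lie_algebra \<subseteq> vector_space_char_0
  by unfold_locales

section \<open>Insertion and its graded pre-Lie identity\<close>

context vector_space_char_0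
begin

text \<open>Carries no degrees: \<open>P\<close> vanishes on lists of the wrong length and an
  alternating \<open>Q\<close> vanishes when its first argument is 0, which singles out one size of
  \<open>ys\<close>.\<close>

definition ins :: "('g list \<Rightarrow> 'g) \<Rightarrow> ('g list \<Rightarrow> 'g) \<Rightarrow> 'g list \<Rightarrow> 'g" where
  "ins P Q xs = unshuffle_sum xs (\<lambda>ys zs. Q (P ys # zs))"

lemma ins_Nil: "ins P Q [] = Q [P []]"
  by (simp add: ins_def)

lemma ins_add_right: "ins P (Q + R) = ins P Q + ins P R"
  by (intro ext) (simp add: ins_def unshuffle_sum_add)

lemma ins_scale_right: "ins P (fun_scale scale c Q) = fun_scale scale c (ins P Q)"
  by (intro ext) (simp add: ins_def fun_scale_def unshuffle_sum_hom[of "scale c"] scale_right_distrib)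

lemma ins_uminus_right: "ins P (- Q) = - ins P Q"
  by (intro ext) (simp add: ins_def unshuffle_sum_hom[of uminus])

lemma ins_add_left: "R \<in> alts k \<Longrightarrow> ins (P + Q) R = ins P R + ins Q R"
  by (intro ext) (simp add: ins_def unshuffle_sum_add alts_Cons_add)

lemma ins_scale_left: "R \<in> alts k \<Longrightarrow> ins (fun_scale scale c P) R = fun_scale scale c (ins P R)"
  by (intro ext) (simp add: ins_def fun_scale_def unshuffle_sum_hom[of "scale c"] scale_right_distrib alts_Cons_scale)

lemma ins_uminus_left: "R \<in> alts k \<Longrightarrow> ins (- P) R = - ins P R"
  by (intro ext) (simp add: ins_def unshuffle_sum_hom[of uminus] alts_Cons_uminus)

lemma ins_diff_right: "ins P (Q - R) = ins P Q - ins P R"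
  using ins_add_right[of P Q "- R"] by (simp add: ins_uminus_right)

lemma ins_diff_left: "R \<in> alts k \<Longrightarrow> ins (P - Q) R = ins P R - ins Q R"
  using ins_add_left[of R k P "- Q"] by (simp add: ins_uminus_left)

lemma ins_signed_right: "ins P (signed k Q) = signed k (ins P Q)"
  by (simp add: signed_def ins_uminus_right)

lemma ins_signed_left: "R \<in> alts k \<Longrightarrow> ins (signed m P) R = signed m (ins P R)"
  by (simp add: signed_def ins_uminus_left)

text \<open>The head \<open>x\<close> goes either into \<open>P\<close> or into the tail of
  \<open>Q\<close>. In the second case it passes the \<open>i\<close> arguments of \<open>P\<close>
  and the slot filled by the value of \<open>P\<close>, hence the exponent
  \<open>i + 1\<close>.\<close>

lemma contract_ins:
  assumes P: "P \<in> alts i" and Q: "Q \<in> alts j"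
  shows "contract x (ins P Q) = ins (contract x P) Q + signed (i + 1) (ins P (contract x Q))"
proof
  fix xs
  have "(if even (length ys) then Q (P ys # x # zs) else - Q (P ys # x # zs))
      = signed (i + 1) (Q (x # P ys # zs))" for ys zs
  proof (cases "int (length ys) = i")
    case True
    then have "even (length ys) \<longleftrightarrow> even i" by auto
    then show ?thesis
      by (simp add: signed_def alts_swap[OF Q, of "P ys" x zs])
  next
    \<comment> \<open>For \<open>ys\<close> of the wrong length \<open>P ys = 0\<close>, and both
      sides vanish.\<close>
    case False
    then show ?thesis
      using alts_swap[OF Q, of x 0] by (simp add: alts_length[OF P] alts_Cons_0[OF Q] signed_def)
  qed
  then have "contract x (ins P Q) xs = unshuffle_sum xs (\<lambda>ys zs. Q (P (x # ys) # zs))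
      + unshuffle_sum xs (\<lambda>ys zs. signed (i + 1) (Q (x # P ys # zs)))"
    by (simp add: contract_def ins_def)
  also have "unshuffle_sum xs (\<lambda>ys zs. signed (i + 1) (Q (x # P ys # zs)))
      = signed (i + 1) (unshuffle_sum xs (\<lambda>ys zs. Q (x # P ys # zs)))"
    by (rule unshuffle_sum_hom) (simp add: signed_def)
  finally show "contract x (ins P Q) xs
      = (ins (contract x P) Q + signed (i + 1) (ins P (contract x Q))) xs"
    by (simp add: ins_def contract_def signed_apply)
qed

lemma ins_Cons:
  "P \<in> alts i \<Longrightarrow> Q \<in> alts j \<Longrightarrow>
    ins P Q (x # xs) = ins (contract x P) Q xs + signed (i + 1) (ins P (contract x Q) xs)"
  using fun_cong[OF contract_ins[of P i Q j x], of xs] by (simp add: contract_def signed_apply)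

lemma ins_alts:
  assumes "P \<in> alts i" "Q \<in> alts j"
  shows "ins P Q \<in> alts (i + j - 1)"
proof (rule alts_product[OF _ _ _ _ _ _ assms])
  \<comment> \<open>The value is \<open>Q [P []]\<close>, which can be nonzero only for
    \<open>i = 0\<close> and \<open>j = 1\<close>.\<close>
  show "ins P Q [] = 0" if "P \<in> alts i" "Q \<in> alts j" "i + j \<noteq> 1" for i j P Q
    using that alts_length[of P i "[]"] alts_length[of Q j "[P []]"]
    by (cases "i = 0") (auto simp: ins_Nil alts_Cons_0)
  show "contract x (ins P Q) = ins (contract x P) Q + signed (i + 1) (ins P (contract x Q))"
    if "P \<in> alts i" "Q \<in> alts j" for i j P Q x
    using that by (rule contract_ins)
qed (rule ins_add_right ins_scale_right | erule ins_add_left ins_scale_left)+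

text \<open>Subtracting the nested from the iterated insertion leaves \<open>P\<close> and
  \<open>Q\<close> in different slots of \<open>R\<close>, which is graded symmetric in
  \<open>P\<close> and \<open>Q\<close>. This is the graded pre-Lie identity, with arity
  \<open>i\<close> in degree \<open>i - 1\<close>.\<close>

lemma ins_ins:
  assumes "P \<in> alts i" "Q \<in> alts j" "R \<in> alts k"
  shows "ins (ins P Q) R xs - signed ((i - 1) * (j - 1)) (ins (ins Q P) R xs)
    = ins P (ins Q R) xs - signed ((i - 1) * (j - 1)) (ins Q (ins P R) xs)"
  using assms
proof -
  define D where "D i j P Q R xs =
      ins (ins P Q) R xs - signed ((i - 1) * (j - 1)) (ins (ins Q P) R xs)
      - (ins P (ins Q R) xs - signed ((i - 1) * (j - 1)) (ins Q (ins P R) xs))" for i j P Q R xs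
  have "D i j P Q R xs = 0"
    using assms
  proof (induction xs arbitrary: P Q R i j k)
    case Nil
    note P = Nil.prems(1) and Q = Nil.prems(2) and R = Nil.prems(3)
    \<comment> \<open>For \<open>i = j = 0\<close> the nested terms cancel, and this antisymmetry is
      all that the identity says on the empty list.\<close>
    have *: "R [P [], Q []] = - R [Q [], P []]"
      by (rule alts_swap[OF R])
    show ?case
    proof (cases "i = 0 \<and> j = 0")
      case True
      then show ?thesis
        using * alts_Cons_add[OF R, of "Q [P []]" "P [Q []]" "[]"]
        by (simp add: D_def ins_Nil ins_Cons[OF Q R] ins_Cons[OF P R] contract_def signed_def)
    next
      case False
      then have "P [] = 0 \<or> Q [] = 0"
        using alts_length[OF P, of "[]"] alts_length[OF Q, of "[]"] by auto
      moreover have "R [x, 0] = 0" "R [0, x] = 0" for x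
        using alts_swap[OF R, of x 0] alts_Cons_0[OF R] by auto
      ultimately show ?thesis
        by (auto simp: D_def ins_Nil ins_Cons[OF Q R] ins_Cons[OF P R] contract_def signed_def)
    qed
  next
    case (Cons x xs)
    note P = Cons.prems(1) and Q = Cons.prems(2) and R = Cons.prems(3)
    note Px = alts_contract[OF P, of x] and Qx = alts_contract[OF Q, of x] and Rx = alts_contract[OF R, of x]
    note rules = ins_Cons[OF ins_alts[OF P Q] R] ins_Cons[OF ins_alts[OF Q P] R]
      ins_Cons[OF P ins_alts[OF Q R]] ins_Cons[OF Q ins_alts[OF P R]]
      contract_ins[OF P Q] contract_ins[OF Q P] contract_ins[OF P R] contract_ins[OF Q R]
      ins_add_left[OF R] ins_diff_left[OF R] ins_uminus_left[OF R]
      ins_add_right ins_diff_right ins_uminus_right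
    text \<open>The defect \<open>D\<close> is itself a graded trilinear operation along which contractions are derivations.\<close>
    have "D i j P Q R (x # xs) = D (i - 1) j (contract x P) Q R xs
        + signed (i + 1) (D i (j - 1) P (contract x Q) R xs)
        + signed (i + j) (D i j P Q (contract x R) xs)"
      by (cases "even i"; cases "even j") (simp_all add: D_def rules signed_def algebra_simps)
    then show ?case
      using Cons.IH[OF Px Q R] Cons.IH[OF P Qx R] Cons.IH[OF P Q Rx] by (simp add: signed_def)
  qed
  then show ?thesis by (simp add: D_def)
qed

end

section \<open>The cup product and the action of insertions on it\<close>

context lie_algebra
begin

lemma br_add_left: "br (x + y) z = br x z + br y z"
  and br_scale_left: "br (scale c x) z = scale c (br x z)"
  and br_add_right: "br z (x + y) = br z x + br z y"
  and br_scale_right: "br z (scale c x) = scale c (br z x)"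
  using br_linear_left[of z] br_linear_right[of z] by (simp_all add: linear_scale_iff)

lemma br_0_left: "br 0 x = 0" and br_0_right: "br x 0 = 0"
  using br_add_left[of 0 0 x] br_add_right[of x 0 0] by simp_all

lemma br_uminus_left: "br (- x) y = - br x y"
  and br_uminus_right: "br x (- y) = - br x y"
  using br_scale_left[of "- 1" x y] br_scale_right[of x "- 1" y] by simp_all

lemma br_skew: "br x y = - br y x"
  by (rule biadditive_skew) (simp_all add: br_add_left br_add_right br_self)

lemma br_jacobi_derivation: "br x (br y z) = br (br x y) z + br y (br x z)"
  using br_jacobi[of x y z] br_skew[of "br x y" z] br_skew[of z x]
  by (simp add: br_uminus_right algebra_simps add_eq_0_iff2)

definition cup :: "('g list \<Rightarrow> 'g) \<Rightarrow> ('g list \<Rightarrow> 'g) \<Rightarrow> 'g list \<Rightarrow> 'g" where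
  "cup P Q xs = unshuffle_sum xs (\<lambda>ys zs. br (P ys) (Q zs))"

lemma cup_Nil: "cup P Q [] = br (P []) (Q [])"
  by (simp add: cup_def)

lemma cup_add_right: "cup P (Q + R) = cup P Q + cup P R"
  by (intro ext) (simp add: cup_def unshuffle_sum_add br_add_right)

lemma cup_scale_right: "cup P (fun_scale scale c Q) = fun_scale scale c (cup P Q)"
  by (intro ext) (simp add: cup_def fun_scale_def unshuffle_sum_hom[of "scale c"] scale_right_distrib br_scale_right)

lemma cup_add_left: "cup (P + Q) R = cup P R + cup Q R"
  by (intro ext) (simp add: cup_def unshuffle_sum_add br_add_left)

lemma cup_scale_left: "cup (fun_scale scale c P) R = fun_scale scale c (cup P R)"
  by (intro ext) (simp add: cup_def fun_scale_def unshuffle_sum_hom[of "scale c"] scale_right_distrib br_scale_left)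

lemma cup_uminus_right: "cup P (- Q) = - cup P Q"
  by (intro ext) (simp add: cup_def unshuffle_sum_hom[of uminus] br_uminus_right)

lemma cup_uminus_left: "cup (- P) Q = - cup P Q"
  by (intro ext) (simp add: cup_def unshuffle_sum_hom[of uminus] br_uminus_left)

lemma cup_diff_right: "cup P (Q - R) = cup P Q - cup P R"
  using cup_add_right[of P Q "- R"] by (simp add: cup_uminus_right)

lemma cup_diff_left: "cup (P - Q) R = cup P R - cup Q R"
  using cup_add_left[of P "- Q" R] by (simp add: cup_uminus_left)

text \<open>No slot is filled by a value of \<open>P\<close> here, so moving \<open>x\<close> past
  the arguments of \<open>P\<close> gives the exponent \<open>i\<close> alone.\<close>

lemma contract_cup:
  assumes P: "P \<in> alts i"
  shows "contract x (cup P Q) = cup (contract x P) Q + signed i (cup P (contract x Q))"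
proof
  fix xs
  have "(if even (length ys) then br (P ys) (Q (x # zs)) else - br (P ys) (Q (x # zs)))
      = signed i (br (P ys) (Q (x # zs)))" for ys zs
    using alts_length[OF P, of ys] by (cases "int (length ys) = i") (auto simp: signed_def br_0_left)
  then have "contract x (cup P Q) xs = unshuffle_sum xs (\<lambda>ys zs. br (P (x # ys)) (Q zs))
      + unshuffle_sum xs (\<lambda>ys zs. signed i (br (P ys) (Q (x # zs))))"
    by (simp add: contract_def cup_def)
  also have "unshuffle_sum xs (\<lambda>ys zs. signed i (br (P ys) (Q (x # zs))))
      = signed i (unshuffle_sum xs (\<lambda>ys zs. br (P ys) (Q (x # zs))))"
    by (rule unshuffle_sum_hom) (simp add: signed_def)
  finally show "contract x (cup P Q) xs = (cup (contract x P) Q + signed i (cup P (contract x Q))) xs"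
    by (simp add: cup_def contract_def signed_apply)
qed

lemma cup_Cons:
  "P \<in> alts i \<Longrightarrow> cup P Q (x # xs) = cup (contract x P) Q xs + signed i (cup P (contract x Q) xs)"
  using fun_cong[OF contract_cup[of P i x Q], of xs] by (simp add: contract_def signed_apply)

lemma cup_alts:
  assumes "P \<in> alts i" "Q \<in> alts j"
  shows "cup P Q \<in> alts (i + j)"
proof -
  have "cup P Q \<in> alts (i + j - 0)"
  proof (rule alts_product[OF _ _ _ _ _ _ assms])
    show "cup P Q [] = 0" if "P \<in> alts i" "Q \<in> alts j" "i + j \<noteq> 0" for i j P Q
      using that alts_length[of P i "[]"] alts_length[of Q j "[]"]
      by (cases "i = 0") (auto simp: cup_Nil br_0_left br_0_right)
    show "contract x (cup P Q) = cup (contract x P) Q + signed (i + 0) (cup P (contract x Q))"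
      if "P \<in> alts i" for i P Q x
      using contract_cup[OF that] by simp
  qed (rule cup_add_left cup_add_right cup_scale_left cup_scale_right)+
  then show ?thesis by simp
qed

text \<open>Contracting \<open>P\<close> changes the exponent \<open>i * j\<close> by
  \<open>j\<close>, which matches the sign from moving \<open>x\<close> past \<open>Q\<close> in
  \<open>cup Q P\<close>; likewise for \<open>Q\<close>, so the contracted instances add up.\<close>

lemma cup_skew:
  assumes "P \<in> alts i" "Q \<in> alts j"
  shows "cup P Q xs = - signed (i * j) (cup Q P xs)"
  using assms
proof (induction xs arbitrary: P Q i j)
  case Nil
  show ?case
  proof (cases "i = 0 \<and> j = 0")
    case True
    then show ?thesis by (simp add: cup_Nil signed_def br_skew[of "P []"])
  next
    case False
    then have "P [] = 0 \<or> Q [] = 0"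
      using alts_length[OF Nil(1), of "[]"] alts_length[OF Nil(2), of "[]"] by auto
    then show ?thesis by (auto simp: cup_Nil signed_def br_0_left br_0_right)
  qed
next
  case (Cons x xs)
  note P = Cons.prems(1) and Q = Cons.prems(2)
  show ?case
    using Cons.IH[OF alts_contract[OF P, of x] Q] Cons.IH[OF P alts_contract[OF Q, of x]]
    by (cases "even i"; cases "even j") (simp_all add: cup_Cons[OF P] cup_Cons[OF Q] signed_def)
qed

lemma cup_jacobi:
  assumes "P \<in> alts i" "Q \<in> alts j" "R \<in> alts k"
  shows "cup P (cup Q R) xs = cup (cup P Q) R xs + signed (i * j) (cup Q (cup P R) xs)"
  using assms
proof (induction xs arbitrary: P Q R i j k)
  case Nil
  show ?case
  \<comment> \<open>In degree 0 this is the Jacobi identity of \<open>br\<close>; otherwise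
    \<open>P []\<close> or \<open>Q []\<close> is zero and every term vanishes with it.\<close>
  proof (cases "i = 0 \<and> j = 0")
    case True
    then show ?thesis by (simp add: cup_Nil signed_def br_jacobi_derivation[of "P []"])
  next
    case False
    then have "P [] = 0 \<or> Q [] = 0"
      using alts_length[OF Nil(1), of "[]"] alts_length[OF Nil(2), of "[]"] by auto
    then show ?thesis by (auto simp: cup_Nil signed_def br_0_left br_0_right)
  qed
next
  case (Cons x xs)
  note P = Cons.prems(1) and Q = Cons.prems(2) and R = Cons.prems(3)
  note Px = alts_contract[OF P, of x] and Qx = alts_contract[OF Q, of x] and Rx = alts_contract[OF R, of x]
  note rules = cup_Cons[OF P] cup_Cons[OF Q] cup_Cons[OF cup_alts[OF P Q]] contract_cup[OF P] contract_cup[OF Q]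
    cup_add_left cup_add_right cup_diff_left cup_diff_right cup_uminus_left cup_uminus_right
  show ?case
    using Cons.IH[OF Px Q R] Cons.IH[OF P Qx R] Cons.IH[OF P Q Rx]
    by (cases "even i"; cases "even j") (simp_all add: rules signed_def algebra_simps)
qed

text \<open>The value of \<open>P\<close> fills one slot of \<open>cup Q R\<close>, belonging to
  \<open>Q\<close> or to \<open>R\<close>; in the second case \<open>P\<close>, of degree
  \<open>i - 1\<close>, passes \<open>Q\<close>.\<close>

lemma ins_cup:
  assumes "P \<in> alts i" "Q \<in> alts j" "R \<in> alts k"
  shows "ins P (cup Q R) xs = cup (ins P Q) R xs + signed ((i - 1) * j) (cup Q (ins P R) xs)"
  using assms
proof (induction xs arbitrary: P Q R i j k)
  case Nil
  note P = Nil.prems(1) and Q = Nil.prems(2) and R = Nil.prems(3)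
  \<comment> \<open>On the empty list the term containing \<open>Q []\<close> has exponent
    \<open>j\<close> on one side and \<open>(i - 1) * j\<close> on the other; these signs can differ
    only where \<open>Q [] = 0\<close>.\<close>
  have "Q [] = 0" if "j \<noteq> 0"
    using alts_length[OF Q, of "[]"] that by auto
  then show ?case
    by (cases "j = 0") (simp_all add: ins_Nil cup_Nil cup_Cons[OF Q] contract_def signed_def br_0_left)
next
  case (Cons x xs)
  note P = Cons.prems(1) and Q = Cons.prems(2) and R = Cons.prems(3)
  note Px = alts_contract[OF P, of x] and Qx = alts_contract[OF Q, of x] and Rx = alts_contract[OF R, of x]
  note rules = ins_Cons[OF P cup_alts[OF Q R]] cup_Cons[OF Q] cup_Cons[OF ins_alts[OF P Q]]
    contract_cup[OF Q] contract_ins[OF P Q] contract_ins[OF P R]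
    cup_add_left cup_add_right cup_diff_left cup_diff_right cup_uminus_left cup_uminus_right
    ins_add_right ins_diff_right ins_uminus_right
  show ?case
    using Cons.IH[OF Px Q R] Cons.IH[OF P Qx R] Cons.IH[OF P Q Rx]
    by (cases "even i"; cases "even j") (simp_all add: rules signed_def algebra_simps)
qed

end

section \<open>The matched pair\<close>

context vector_space_char_0
begin

lemma fun_scale_vector_space: "vector_space (fun_scale scale)"
  by unfold_locales (auto simp: fun_scale_def algebra_simps)

lemma fun_scale_powi_eq_signed: "fun_scale scale ((-1) powi i) P = signed i P"
  by (auto simp: fun_scale_def scale_powi_eq_signed signed_apply)

lemma fun_scale_add: "fun_scale scale c (P + Q) = fun_scale scale c P + fun_scale scale c Q"
  and fun_scale_diff: "fun_scale scale c (P - Q) = fun_scale scale c P - fun_scale scale c Q"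
  and fun_scale_fun_scale: "fun_scale scale c (fun_scale scale d P) = fun_scale scale (c * d) P"
  by (auto simp: fun_scale_def scale_right_distrib scale_right_diff_distrib)

lemma ins_0_left: "R \<in> alts k \<Longrightarrow> ins 0 R = 0"
  and ins_0_right: "ins P 0 = 0"
  by (intro ext, simp add: ins_def alts_Cons_0)+

lemma insertion_hom_eq_ins:
  assumes P: "P \<in> alt_hom scale (m + 1)" and Q: "Q \<in> alt_hom scale n"
  shows "insertion_hom scale m n P Q = ins P Q"
proof
  fix xs
  have P': "P \<in> alts (int m + 1)" and Q': "Q \<in> alts (int n)"
    using P Q by (simp_all add: nonneg_graded_def nat_add_distrib)
  show "insertion_hom scale m n P Q xs = ins P Q xs"
  proof (cases "n = 0 \<or> length xs \<noteq> m + n")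
    case True
    have "ins P Q xs = 0"
    \<comment> \<open>The convention for \<open>n = 0\<close> agrees with \<open>ins\<close>, which
      would apply \<open>Q\<close> to a nonempty list.\<close>
    proof (cases "n = 0")
      case True
      then show ?thesis by (simp add: ins_def alt_hom_length[OF Q])
    next
      case False
      with True show ?thesis
        using alts_length[OF ins_alts[OF P' Q'], of xs] by simp
    qed
    with True show ?thesis by (auto simp: insertion_hom_def)
  next
    case False
    then have "(m + 1) + (n - 1) = m + n" "length xs = (m + 1) + (n - 1)" by auto
    then have "insertion_hom scale m n P Q xs
        = unshuffle_sum xs (\<lambda>ys zs. if length ys = m + 1 then Q (P ys # zs) else 0)"
      using sum_shuffle_perms_select[of xs "m + 1" "n - 1" "\<lambda>ys zs. Q (P ys # zs)"] False
      unfolding insertion_hom_def by (simp only: if_False)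
    also have "\<dots> = ins P Q xs"
      unfolding ins_def
      by (rule unshuffle_sum_cong) (simp add: alt_hom_length[OF P] alts_Cons_0[OF Q'])
    finally show ?thesis .
  qed
qed

section \<open>Bilinearity and grading\<close>

lemma insertion_hom_add_left:
  assumes "\<And>zs. Vector_Spaces.linear scale scale (\<lambda>x. Q (x # zs))"
  shows "insertion_hom scale m n (P + P') Q = insertion_hom scale m n P Q + insertion_hom scale m n P' Q"
  using assms by (intro ext) (simp add: insertion_hom_def linear_scale_iff scale_right_distrib sum.distrib)

lemma insertion_hom_scale_left:
  assumes "\<And>zs. Vector_Spaces.linear scale scale (\<lambda>x. Q (x # zs))"
  shows "insertion_hom scale m n (fun_scale scale c P) Q = fun_scale scale c (insertion_hom scale m n P Q)"
  using assms by (intro ext) (simp add: insertion_hom_def linear_scale_iff fun_scale_def scale_sum_right mult.commute)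

lemma insertion_hom_add_right:
  "insertion_hom scale m n P (Q + Q') = insertion_hom scale m n P Q + insertion_hom scale m n P Q'"
  by (intro ext) (simp add: insertion_hom_def scale_right_distrib sum.distrib)

lemma insertion_hom_scale_right:
  "insertion_hom scale m n P (fun_scale scale c Q) = fun_scale scale c (insertion_hom scale m n P Q)"
  by (intro ext) (simp add: insertion_hom_def fun_scale_def scale_sum_right mult.commute)

text \<open>Bilinearity is demanded on sums of maps of different degrees as well, so it is read off
  the shuffle formula; of the maps in \<open>B\<close> only linearity in the first slot is
  used.\<close>

lemma insertion_bilinear_on:
  assumes "\<And>Q zs. Q \<in> B \<Longrightarrow> Vector_Spaces.linear scale scale (\<lambda>x. Q (x # zs))"
  shows "bilinear_on (fun_scale scale) (fun_scale scale) (fun_scale scale) A B (insertion scale)"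
  unfolding bilinear_on_def using assms
  by (auto simp: insertion_def fun_eq_iff fun_scale_def[of scale _ "insertion scale _ _"]
      insertion_hom_add_left insertion_hom_add_right insertion_hom_scale_left insertion_hom_scale_right
      sum.distrib scale_sum_right case_prod_unfold)
     (auto simp: fun_scale_def insertion_def scale_sum_right)

lemma nr_bracket_bilinear_on:
  assumes "\<And>Q zs. Q \<in> A \<Longrightarrow> Vector_Spaces.linear scale scale (\<lambda>x. Q (x # zs))"
  shows "bilinear_on (fun_scale scale) (fun_scale scale) (fun_scale scale) A A (nr_bracket scale)"
proof -
  have "nr_hom scale m n (P + P') Q = nr_hom scale m n P Q + nr_hom scale m n P' Q"
    "nr_hom scale m n (fun_scale scale c P) Q = fun_scale scale c (nr_hom scale m n P Q)"
    "nr_hom scale m n Q (P + P') = nr_hom scale m n Q P + nr_hom scale m n Q P'"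
    "nr_hom scale m n Q (fun_scale scale c P) = fun_scale scale c (nr_hom scale m n Q P)"
    if "Q \<in> A" for m n c P P' Q
    using assms[OF that]
    by (simp_all add: nr_hom_def insertion_hom_add_left insertion_hom_add_right insertion_hom_scale_left
        insertion_hom_scale_right fun_scale_add fun_scale_diff fun_scale_fun_scale mult.commute algebra_simps)
  then show ?thesis
    unfolding bilinear_on_def
    by (auto simp: nr_bracket_def sum.distrib case_prod_unfold)
     (auto simp: fun_scale_def nr_bracket_def scale_sum_right)
qed

lemma graded_vector_space_alt_hom:
  "graded_vector_space (fun_scale scale) (nonneg_graded (\<lambda>n. alt_hom scale (n + d)))"
    (is "graded_vector_space _ ?V")
proof -
  interpret F: vector_space "fun_scale scale"
    by (rule fun_scale_vector_space)
  show ?thesis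
  proof
    show "F.subspace (?V i)" for i
      by (rule F.subspaceI) (auto simp: nonneg_graded_def zero_alt_hom alt_hom_add alt_hom_fun_scale fun_scale_0)
  next
    fix I :: "int set" and v j
    assume I: "finite I" "\<And>i. i \<in> I \<Longrightarrow> v i \<in> ?V i" "(\<Sum>i\<in>I. v i) = 0" "j \<in> I"
    have vanish: "v i xs = 0" if "i \<in> I" "int (length xs) \<noteq> i + int d" for i xs
      using I(2)[OF that(1)] that(2) alt_hom_length[of "v i" scale "nat i + d" xs]
      by (auto simp: nonneg_graded_def split: if_splits)
    show "v j = 0"
    proof
      fix xs
      \<comment> \<open>On lists of length \<open>j + d\<close> only the component
        \<open>v j\<close> survives, so evaluating the vanishing sum there isolates it.\<close>
      have "v j xs = (\<Sum>i\<in>I. v i xs)" if "int (length xs) = j + int d"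
        using that I(1,4) vanish by (subst sum.remove[of I j]) (auto intro!: sum.neutral)
      moreover have "(\<Sum>i\<in>I. v i xs) = (\<Sum>i\<in>I. v i) xs"
        using I(1) by (induction I rule: finite_induct) auto
      ultimately show "v j xs = 0 xs"
        using I(3,4) vanish[of j xs] by auto
    qed
  qed
qed

text \<open>The maps linear in the first slot form a subspace containing every component, hence also
  their span.\<close>

lemma linear_on_total_alt_hom:
  assumes "P \<in> graded_vector_space.total (fun_scale scale) (nonneg_graded (\<lambda>n. alt_hom scale (n + d)))"
  shows "Vector_Spaces.linear scale scale (\<lambda>x. P (x # zs))"
proof -
  interpret F: graded_vector_space "fun_scale scale" "nonneg_graded (\<lambda>n. alt_hom scale (n + d))"
    by (rule graded_vector_space_alt_hom)
  let ?T = "{P. \<forall>zs. Vector_Spaces.linear scale scale (\<lambda>x. P (x # zs))}"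
  have "F.subspace ?T"
    by (rule F.subspaceI) (auto simp: linear_scale_iff fun_scale_def algebra_simps)
  moreover have "(\<Union>i. nonneg_graded (\<lambda>n. alt_hom scale (n + d)) i) \<subseteq> ?T"
    using alt_hom_linear by (auto simp: nonneg_graded_def linear_scale_iff split: if_splits)
  ultimately have "F.total \<subseteq> ?T"
    unfolding F.total_def by (rule F.span_minimal[rotated])
  with assms show ?thesis by auto
qed

section \<open>The Nijenhuis-Richardson bracket on homogeneous maps\<close>

abbreviation shifted_alts :: "int \<Rightarrow> ('g list \<Rightarrow> 'g) set" where
  "shifted_alts \<equiv> nonneg_graded (\<lambda>n. alt_hom scale (n + 1))"

lemma shifted_alts_alts: "P \<in> shifted_alts i \<Longrightarrow> P \<in> alts (i + 1)"
  by (auto simp: nonneg_graded_def nat_add_distrib zero_alt_hom split: if_splits)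

text \<open>The second premise matters at \<open>i = - 1\<close>: there \<open>alts 0\<close> is a
  copy of the underlying space, while \<open>shifted_alts (- 1)\<close> is zero.\<close>

lemma shifted_altsI: "P \<in> alts (i + 1) \<Longrightarrow> (i < 0 \<Longrightarrow> P = 0) \<Longrightarrow> P \<in> shifted_alts i"
  by (auto simp: nonneg_graded_def nat_add_distrib split: if_splits)

lemma shifted_alts_neg: "P \<in> shifted_alts i \<Longrightarrow> i < 0 \<Longrightarrow> P = 0"
  by (simp add: nonneg_graded_def)

lemma zero_shifted_alts: "0 \<in> shifted_alts i"
  by (simp add: nonneg_graded_def zero_alt_hom)

text \<open>The degrees are explicit because the zero map lies in every degree and does not
  determine a sign.\<close>

definition nr :: "int \<Rightarrow> int \<Rightarrow> ('g list \<Rightarrow> 'g) \<Rightarrow> ('g list \<Rightarrow> 'g) \<Rightarrow> 'g list \<Rightarrow> 'g" where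
  "nr i j P Q = ins P Q - signed (i * j) (ins Q P)"

lemma nr_shifted_alts:
  assumes "P \<in> shifted_alts i" "Q \<in> shifted_alts j"
  shows "nr i j P Q \<in> shifted_alts (i + j)"
proof (rule shifted_altsI)
  note P = shifted_alts_alts[OF assms(1)] and Q = shifted_alts_alts[OF assms(2)]
  have "ins P Q + - signed (i * j) (ins Q P) \<in> alts (i + j + 1)"
    using ins_alts[OF P Q] ins_alts[OF Q P]
    by (intro alts_add alts_uminus alts_signed) (simp_all add: algebra_simps)
  then show "nr i j P Q \<in> alts (i + j + 1)"
    by (simp add: nr_def)
  assume "i + j < 0"
  then have "P = 0 \<or> Q = 0"
    using shifted_alts_neg[OF assms(1)] shifted_alts_neg[OF assms(2)] by linarith
  then show "nr i j P Q = 0"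
    using ins_0_left[OF P] ins_0_left[OF Q] by (auto simp: nr_def ins_0_right signed_def)
qed

lemma nr_skew: "nr i j P Q = - signed (i * j) (nr j i Q P)"
  by (simp add: nr_def signed_def mult.commute)

text \<open>The pre-Lie identity solved for the commutator. It serves both as the action property
  and as input for the Jacobi identity.\<close>

lemma ins_nr:
  assumes "P \<in> shifted_alts i" "Q \<in> shifted_alts j" "R \<in> alts k"
  shows "ins (nr i j P Q) R = ins P (ins Q R) - signed (i * j) (ins Q (ins P R))"
  using ins_ins[OF shifted_alts_alts[OF assms(1)] shifted_alts_alts[OF assms(2)] assms(3)]
  by (intro ext) (simp add: nr_def ins_diff_left[OF assms(3)] ins_signed_left[OF assms(3)] signed_apply)

text \<open>The commutator of a graded pre-Lie product satisfies the graded Jacobi identity: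
  \<open>ins_nr\<close> turns every term into a right-nested insertion, and these cancel for each
  choice of parities.\<close>

lemma nr_jacobi:
  assumes P: "P \<in> shifted_alts i" and Q: "Q \<in> shifted_alts j" and R: "R \<in> shifted_alts k"
  shows "nr i (j + k) P (nr j k Q R)
    = nr (i + j) k (nr i j P Q) R + signed (i * j) (nr j (i + k) Q (nr i k P R))"
  unfolding nr_def[of i "j + k"] nr_def[of "i + j" k] nr_def[of j "i + k"]
    ins_nr[OF P Q shifted_alts_alts[OF R]] ins_nr[OF Q R shifted_alts_alts[OF P]]
    ins_nr[OF P R shifted_alts_alts[OF Q]]
  unfolding nr_def ins_diff_right ins_signed_right
  by (cases "even i"; cases "even j"; cases "even k") (simp_all add: signed_def algebra_simps)

end

section \<open>The defined operations on homogeneous maps, and the matched pair axioms\<close>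

context lie_algebra
begin

text \<open>In negative degree the map is zero and \<open>m = 0\<close> is an arbitrary choice,
  which the disjunction records.\<close>

lemma shifted_alts_obtain:
  assumes "P \<in> shifted_alts i"
  obtains m where "P \<in> alt_hom scale (m + 1)" "i = int m \<or> P = 0"
  using assms zero_alt_hom[of "0 + 1"]
  by (cases "0 \<le> i") (force simp: nonneg_graded_def intro: that[of "nat i"] that[of 0])+

lemma alts_obtain:
  assumes "P \<in> alts i"
  obtains m where "P \<in> alt_hom scale m"
  using assms zero_alt_hom[of 0]
  by (cases "0 \<le> i") (force simp: nonneg_graded_def intro: that[of "nat i"] that[of 0])+

lemma insertion_eq_ins:
  assumes "P \<in> shifted_alts i" "Q \<in> alts j"
  shows "insertion scale P Q = ins P Q"
proof -
  obtain m n where "P \<in> alt_hom scale (m + 1)" "Q \<in> alt_hom scale n"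
    using shifted_alts_obtain[OF assms(1)] alts_obtain[OF assms(2)] by metis
  then show ?thesis
    by (simp add: insertion_homogeneous insertion_hom_eq_ins)
qed

lemma nr_bracket_eq_nr:
  assumes "P \<in> shifted_alts i" "Q \<in> shifted_alts j"
  shows "nr_bracket scale P Q = nr i j P Q"
proof -
  obtain m where P: "P \<in> alt_hom scale (m + 1)" "i = int m \<or> P = 0"
    using shifted_alts_obtain[OF assms(1)] .
  obtain n where Q: "Q \<in> alt_hom scale (n + 1)" "j = int n \<or> Q = 0"
    using shifted_alts_obtain[OF assms(2)] .
  have "nr_bracket scale P Q = ins P Q - fun_scale scale ((-1) ^ (m * n)) (ins Q P)"
    unfolding nr_bracket_homogeneous[OF P(1) Q(1)] nr_hom_def
      insertion_hom_eq_ins[OF P(1) Q(1)] insertion_hom_eq_ins[OF Q(1) P(1)] by (rule refl)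
  also have "\<dots> = nr i j P Q"
  proof (cases "i = int m \<and> j = int n")
    case True
    then have "fun_scale scale ((-1) ^ (m * n)) (ins Q P) = signed (i * j) (ins Q P)"
      using fun_scale_powi_eq_signed[of "int (m * n)" "ins Q P", unfolded power_int_of_nat] by simp
    then show ?thesis by (simp add: nr_def)
  next
    case False
    \<comment> \<open>Where the natural degrees do not match the integer ones a factor is zero, and
      both insertions vanish whatever the sign.\<close>
    then have "P = 0 \<or> Q = 0" using P(2) Q(2) by auto
    then have "ins P Q = 0" "ins Q P = 0"
      using ins_0_left[OF shifted_alts_alts[OF assms(1)]] ins_0_left[OF shifted_alts_alts[OF assms(2)]]
      by (auto simp: ins_0_right)
    then show ?thesis by (simp add: nr_def signed_def fun_scale_0)
  qed
  finally show ?thesis .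
qed

lemma cup_hom_eq_cup:
  assumes P: "P \<in> alt_hom scale m" and Q: "Q \<in> alt_hom scale n"
  shows "cup_hom scale br m n P Q = cup P Q"
proof
  fix xs
  have P': "P \<in> alts (int m)" and Q': "Q \<in> alts (int n)"
    using P Q by (simp_all add: nonneg_graded_def)
  show "cup_hom scale br m n P Q xs = cup P Q xs"
  proof (cases "length xs = m + n")
    case True
    then have "cup_hom scale br m n P Q xs
        = unshuffle_sum xs (\<lambda>ys zs. if length ys = m then br (P ys) (Q zs) else 0)"
      using sum_shuffle_perms_select[of xs m n "\<lambda>ys zs. br (P ys) (Q zs)"]
      by (simp add: cup_hom_def)
    also have "\<dots> = cup P Q xs"
      unfolding cup_def by (rule unshuffle_sum_cong) (simp add: alt_hom_length[OF P] br_0_left)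
    finally show ?thesis .
  next
    case False
    then show ?thesis
      using alts_length[OF cup_alts[OF P' Q'], of xs] by (simp add: cup_hom_def)
  qed
qed

lemma cup_bracket_eq_cup:
  assumes "P \<in> alts i" "Q \<in> alts j"
  shows "cup_bracket scale br P Q = cup P Q"
proof -
  obtain m n where "P \<in> alt_hom scale m" "Q \<in> alt_hom scale n"
    using alts_obtain[OF assms(1)] alts_obtain[OF assms(2)] by metis
  then show ?thesis
    by (simp add: cup_bracket_homogeneous cup_hom_eq_cup)
qed

lemma cup_bracket_bilinear_on:
  "bilinear_on (fun_scale scale) (fun_scale scale) (fun_scale scale) A B (cup_bracket scale br)"
proof -
  have "cup_hom scale br m n (P + P') Q = cup_hom scale br m n P Q + cup_hom scale br m n P' Q"
    "cup_hom scale br m n Q (P + P') = cup_hom scale br m n Q P + cup_hom scale br m n Q P'" for m n P P' Q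
    by (intro ext, simp add: cup_hom_def br_add_left br_add_right scale_right_distrib sum.distrib)+
  moreover have "cup_hom scale br m n (fun_scale scale c P) Q = fun_scale scale c (cup_hom scale br m n P Q)"
    "cup_hom scale br m n Q (fun_scale scale c P) = fun_scale scale c (cup_hom scale br m n Q P)" for m n c P Q
    by (intro ext, simp add: cup_hom_def fun_scale_def br_scale_left br_scale_right scale_sum_right mult.commute)+
  ultimately show ?thesis
    unfolding bilinear_on_def
    by (auto simp: cup_bracket_def sum.distrib case_prod_unfold)
     (auto simp: fun_scale_def cup_bracket_def scale_sum_right)
qed

lemma graded_lie_algebra_nr:
  "graded_lie_algebra (fun_scale scale) shifted_alts (nr_bracket scale)"
proof -
  interpret F: graded_vector_space "fun_scale scale" shifted_alts
    by (rule graded_vector_space_alt_hom)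
  show ?thesis
  proof
    show "bilinear_on (fun_scale scale) (fun_scale scale) (fun_scale scale) F.total F.total (nr_bracket scale)"
      by (rule nr_bracket_bilinear_on) (rule linear_on_total_alt_hom)
    show "degree0_map shifted_alts shifted_alts shifted_alts (nr_bracket scale)"
      unfolding degree0_map_def by (intro allI ballI) (simp only: nr_bracket_eq_nr nr_shifted_alts)
    show "nr_bracket scale P Q = - fun_scale scale ((-1) powi (i * j)) (nr_bracket scale Q P)"
      if "P \<in> shifted_alts i" "Q \<in> shifted_alts j" for P Q i j
      unfolding fun_scale_powi_eq_signed nr_bracket_eq_nr[OF that] nr_bracket_eq_nr[OF that(2,1)]
      by (rule nr_skew)
    show "nr_bracket scale P (nr_bracket scale Q R) = nr_bracket scale (nr_bracket scale P Q) R
        + fun_scale scale ((-1) powi (i * j)) (nr_bracket scale Q (nr_bracket scale P R))"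
      if P: "P \<in> shifted_alts i" and Q: "Q \<in> shifted_alts j" and R: "R \<in> shifted_alts k" for P Q R i j k
      unfolding fun_scale_powi_eq_signed nr_bracket_eq_nr[OF P Q] nr_bracket_eq_nr[OF Q R] nr_bracket_eq_nr[OF P R]
        nr_bracket_eq_nr[OF P nr_shifted_alts[OF Q R]] nr_bracket_eq_nr[OF Q nr_shifted_alts[OF P R]]
        nr_bracket_eq_nr[OF nr_shifted_alts[OF P Q] R]
      by (rule nr_jacobi[OF P Q R])
  qed
qed

lemma graded_lie_algebra_cup:
  "graded_lie_algebra (fun_scale scale) alts (cup_bracket scale br)"
proof -
  interpret F: graded_vector_space "fun_scale scale" alts
    using graded_vector_space_alt_hom[of 0] by simp
  show ?thesis
  proof
    show "bilinear_on (fun_scale scale) (fun_scale scale) (fun_scale scale) F.total F.total (cup_bracket scale br)"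
      by (rule cup_bracket_bilinear_on)
    show "degree0_map alts alts alts (cup_bracket scale br)"
      by (simp add: degree0_map_def cup_bracket_eq_cup cup_alts)
    show "cup_bracket scale br P Q = - fun_scale scale ((-1) powi (i * j)) (cup_bracket scale br Q P)"
      if "P \<in> alts i" "Q \<in> alts j" for P Q i j
      unfolding fun_scale_powi_eq_signed cup_bracket_eq_cup[OF that] cup_bracket_eq_cup[OF that(2,1)]
      using cup_skew[OF that] by (intro ext) (simp add: signed_apply)
    show "cup_bracket scale br P (cup_bracket scale br Q R) = cup_bracket scale br (cup_bracket scale br P Q) R
        + fun_scale scale ((-1) powi (i * j)) (cup_bracket scale br Q (cup_bracket scale br P R))"
      if P: "P \<in> alts i" and Q: "Q \<in> alts j" and R: "R \<in> alts k" for P Q R i j k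
      unfolding fun_scale_powi_eq_signed cup_bracket_eq_cup[OF P Q] cup_bracket_eq_cup[OF Q R] cup_bracket_eq_cup[OF P R]
        cup_bracket_eq_cup[OF P cup_alts[OF Q R]] cup_bracket_eq_cup[OF Q cup_alts[OF P R]]
        cup_bracket_eq_cup[OF cup_alts[OF P Q] R]
      using cup_jacobi[OF P Q R] by (intro ext) (simp add: signed_apply)
  qed
qed

text \<open>For \<psi> = 0 the action condition on \<rho> is \<open>ins_nr\<close>, its
  compatibility condition is the derivation property \<open>ins_cup\<close>, and both conditions on
  \<psi> equate zero with zero.\<close>

lemma matched_pair_nr_cup:
  "matched_pair (fun_scale scale) shifted_alts (nr_bracket scale)
    (fun_scale scale) alts (cup_bracket scale br) (insertion scale) (\<lambda>_ _. 0)"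
proof -
  interpret G: graded_lie_algebra "fun_scale scale" shifted_alts "nr_bracket scale"
    by (rule graded_lie_algebra_nr)
  interpret H: graded_lie_algebra "fun_scale scale" alts "cup_bracket scale br"
    by (rule graded_lie_algebra_cup)
  \<comment> \<open>Shifted degree \<open>i\<close> means arity \<open>i + 1\<close>, and
    \<open>(i + 1) + j - 1 = i + j\<close>, so insertion has degree 0.\<close>
  have ins_H: "ins P Q \<in> alts (i + j)" if "P \<in> shifted_alts i" "Q \<in> alts j" for P Q i j
    using ins_alts[OF shifted_alts_alts[OF that(1)] that(2)] by (simp add: algebra_simps)
  show ?thesis
  proof
    show "bilinear_on (fun_scale scale) (fun_scale scale) (fun_scale scale) G.total H.total (insertion scale)"
      by (rule insertion_bilinear_on) (rule linear_on_total_alt_hom[of _ 0], simp)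
    show "degree0_map shifted_alts alts alts (insertion scale)"
      by (simp add: degree0_map_def insertion_eq_ins ins_H)
    show "bilinear_on (fun_scale scale) (fun_scale scale) (fun_scale scale) H.total G.total (\<lambda>_ _. 0)"
      by (simp add: bilinear_on_def fun_scale_0)
    show "degree0_map alts shifted_alts shifted_alts (\<lambda>_ _. 0)"
      unfolding degree0_map_def by (intro allI ballI zero_shifted_alts)
  next
    fix P Q R i j k assume P: "P \<in> shifted_alts i" and Q: "Q \<in> shifted_alts j" and R: "R \<in> alts k"
    show "insertion scale (nr_bracket scale P Q) R = insertion scale P (insertion scale Q R)
        - fun_scale scale ((-1) powi (i * j)) (insertion scale Q (insertion scale P R))"
      unfolding fun_scale_powi_eq_signed nr_bracket_eq_nr[OF P Q] insertion_eq_ins[OF nr_shifted_alts[OF P Q] R]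
        insertion_eq_ins[OF P R] insertion_eq_ins[OF Q R]
        insertion_eq_ins[OF P ins_H[OF Q R]] insertion_eq_ins[OF Q ins_H[OF P R]]
      by (rule ins_nr[OF P Q R])
  next
    fix P Q R i j k assume P: "P \<in> shifted_alts i" and Q: "Q \<in> alts j" and R: "R \<in> alts k"
    \<comment> \<open>The \<psi>-terms of the compatibility condition are insertions of the zero
      map.\<close>
    have "insertion scale 0 Q = 0" "insertion scale 0 R = 0"
      using insertion_eq_ins[OF zero_shifted_alts Q] insertion_eq_ins[OF zero_shifted_alts R]
      by (simp_all add: ins_0_left[OF Q] ins_0_left[OF R])
    moreover have "ins P (cup Q R) = cup (ins P Q) R + signed (i * j) (cup Q (ins P R))"
      using ins_cup[OF shifted_alts_alts[OF P] Q R] by (intro ext) (simp add: signed_apply)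
    ultimately show "insertion scale P (cup_bracket scale br Q R) = cup_bracket scale br (insertion scale P Q) R
        + fun_scale scale ((-1) powi (i * j)) (cup_bracket scale br Q (insertion scale P R))
        + fun_scale scale ((-1) powi ((i + j) * k)) (insertion scale 0 Q)
        - fun_scale scale ((-1) powi (i * j)) (insertion scale 0 R)"
      by (simp add: fun_scale_powi_eq_signed fun_scale_0 cup_bracket_eq_cup[OF Q R] insertion_eq_ins[OF P Q]
          insertion_eq_ins[OF P R] insertion_eq_ins[OF P cup_alts[OF Q R]]
          cup_bracket_eq_cup[OF ins_H[OF P Q] R] cup_bracket_eq_cup[OF Q ins_H[OF P R]] signed_def)
  next
    \<comment> \<open>The values of \<psi> enter the brackets as zero maps.\<close>
    have nr_0: "nr_bracket scale 0 P = 0" "nr_bracket scale P 0 = 0" if "P \<in> shifted_alts i" for P i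
      using nr_bracket_eq_nr[OF zero_shifted_alts that, of 0] nr_bracket_eq_nr[OF that zero_shifted_alts, of 0]
        ins_0_left[OF shifted_alts_alts[OF that]]
      by (simp_all add: nr_def ins_0_right signed_def)
    fix P Q R i j k assume "P \<in> alts i" and Q: "Q \<in> shifted_alts j" and R: "R \<in> shifted_alts k"
    show "0 = nr_bracket scale 0 R + fun_scale scale ((-1) powi (i * j)) (nr_bracket scale Q 0)
        + fun_scale scale ((-1) powi ((i + j) * k)) 0 - fun_scale scale ((-1) powi (i * j)) 0"
      by (simp add: nr_0[OF Q] nr_0[OF R] fun_scale_0)
  qed (simp_all add: fun_scale_0)
qed

end

theorem proposition6p9:
  fixes scale :: "'k::field_char_0 \<Rightarrow> 'g::ab_group_add \<Rightarrow> 'g"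
    and br :: "'g \<Rightarrow> 'g \<Rightarrow> 'g"
  assumes "lie_algebra scale br"
  shows "matched_pair
    (fun_scale scale) (nonneg_graded (\<lambda>n. alt_hom scale (n + 1))) (nr_bracket scale)
    (fun_scale scale) (nonneg_graded (\<lambda>n. alt_hom scale n)) (cup_bracket scale br)
    (insertion scale) (\<lambda>_ _. 0)"
  using assms by (rule lie_algebra.matched_pair_nr_cup)

end
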